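(* Let $X$ be a domain in $\mathbb{C}^n$ and let $K$ and $L$ be sesqui-holomorphic non-degenerate positive semi-definite kernels on $X$. The following are equivalent: (i) $K$ and $L$ are rescallings; (ii) $\tilde\sigma^K=\tilde\sigma^L$; (iii) $\delta_1^K=\delta_1^L$; (iv) $\delta_2^K=\delta_2^L$.
   Context: A domain is an open connected set. A function $K:X\times X\to\mathbb{C}$ is sesqui-holomorphic if it is holomorphic in the first and antiholomorphic in the second variable; $\widehat{K}(x)=K(x,x)$; $K$ is non-degenerate if $\widehat{K}(x)>0$ for all $x\in X$; $K$ is positive semi-definite if all matrices $(K(x_i,x_j))_{i,j}$ are positive semi-definite. Non-degenerate $K,L$ are rescallings if there is a function $\omega:X\to\mathbb{C}$ with $L(x,y)=\omega(x)\overline{\omega(y)}K(x,y)$ for all $x,y\in X$ (this is an equivalence relation). $\tilde\sigma^K$ is the (possibly degenerate) Hermitean form on $X$ with potential $\log\widehat{K}$: $$\tilde\sigma^K=\sum_{j,k=1}^n\frac{\partial^2\log\widehat{K}}{\partial z_j\partial\overline{z_k}}\,dz_j\otimes d\overline{z_k},$$ equivalently the pull-back of the Fubini-Study form $\tilde\sigma_g(f,h)=\frac{\langle f,h\rangle}{\|g\|^2}-\frac{\langle f,g\rangle\langle g,h\rangle}{\|g\|^4}$ on $F^*\setminus\{0\}$ via the evaluation map $X\to F^*$, where $F$ is the RKHS with kernel $K$. Further, for $x,y\in X$, $$\delta_1^K(x,y)=\sqrt{1-\frac{|K(x,y)|^2}{K(x,x)K(y,y)}},\qquad \delta_2^K(x,y)=\sqrt{2-2\frac{|K(x,y)|}{\sqrt{K(x,x)K(y,y)}}}.$$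 *)

theory Defs
  imports "HOL-Analysis.Analysis"
begin

text \<open>Kernels on \<open>X \<subseteq> \<complex>\<^sup>n\<close> are total functions of two vector
  arguments; only their values on \<open>X \<times> X\<close> matter below.\<close>

type_synonym 'n kernel = "complex ^ 'n \<Rightarrow> complex ^ 'n \<Rightarrow> complex"


text \<open>The library's \<open>holomorphic_on\<close> is restricted to one variable. For several variables
  we require a Frechet derivative that is linear over the complex numbers. Both notions below
  are meant for open \<open>X\<close> (hence \<open>at z\<close> rather than \<open>at z within X\<close>).\<close>

definition holomorphic_on_vec :: "(complex ^ 'n \<Rightarrow> complex) \<Rightarrow> (complex ^ 'n) set \<Rightarrow> bool" where
  "holomorphic_on_vec f X \<longleftrightarrow>
     (\<forall>z\<in>X. \<exists>f'. (f has_derivative f') (at z) \<and> (\<forall>c v. f' (c *s v) = c * f' v))"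

definition antiholomorphic_on_vec :: "(complex ^ 'n \<Rightarrow> complex) \<Rightarrow> (complex ^ 'n) set \<Rightarrow> bool" where
  "antiholomorphic_on_vec f X \<longleftrightarrow> holomorphic_on_vec (\<lambda>z. cnj (f z)) X"

definition sesqui_holomorphic :: "(complex ^ 'n) set \<Rightarrow> 'n kernel \<Rightarrow> bool" where
  "sesqui_holomorphic X K \<longleftrightarrow>
     (\<forall>y\<in>X. holomorphic_on_vec (\<lambda>x. K x y) X) \<and>
     (\<forall>x\<in>X. antiholomorphic_on_vec (\<lambda>y. K x y) X)"


definition psd_matrix :: "nat \<Rightarrow> (nat \<Rightarrow> nat \<Rightarrow> complex) \<Rightarrow> bool" where
  "psd_matrix m A \<longleftrightarrow>
     (\<forall>i<m. \<forall>j<m. A j i = cnj (A i j)) \<and>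
     (\<forall>c. 0 \<le> Re (\<Sum>i<m. \<Sum>j<m. cnj (c i) * A i j * c j))"

definition psd_kernel :: "(complex ^ 'n) set \<Rightarrow> 'n kernel \<Rightarrow> bool" where
  "psd_kernel X K \<longleftrightarrow>
     (\<forall>m. \<forall>x. (\<forall>i<m. x i \<in> X) \<longrightarrow> psd_matrix m (\<lambda>i j. K (x i) (x j)))"

definition nondegenerate :: "(complex ^ 'n) set \<Rightarrow> 'n kernel \<Rightarrow> bool" where
  "nondegenerate X K \<longleftrightarrow> (\<forall>x\<in>X. K x x \<in> \<real> \<and> 0 < Re (K x x))"

text \<open>The restriction to the diagonal. \<open>Re\<close> only converts to type \<open>real\<close>: the diagonal
  values of a non-degenerate kernel are real.\<close>

definition kdiag :: "'n kernel \<Rightarrow> complex ^ 'n \<Rightarrow> real" where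
  "kdiag K x = Re (K x x)"

definition rescallings :: "(complex ^ 'n) set \<Rightarrow> 'n kernel \<Rightarrow> 'n kernel \<Rightarrow> bool" where
  "rescallings X K L \<longleftrightarrow>
     (\<exists>\<omega> :: complex ^ 'n \<Rightarrow> complex. \<forall>x\<in>X. \<forall>y\<in>X. L x y = \<omega> x * cnj (\<omega> y) * K x y)"


text \<open>Wirtinger derivatives. With \<open>z\<^sub>j = x\<^sub>j + \<i> y\<^sub>j\<close>, the real partial derivatives in \<open>x\<^sub>j\<close> and
  \<open>y\<^sub>j\<close> are the derivatives in the directions \<open>axis j 1\<close> and \<open>axis j \<i>\<close>.\<close>

definition dir_deriv :: "complex ^ 'n \<Rightarrow> (complex ^ 'n \<Rightarrow> complex) \<Rightarrow> complex ^ 'n \<Rightarrow> complex" where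
  "dir_deriv v f z = vector_derivative (\<lambda>t::real. f (z + t *\<^sub>R v)) (at 0)"

definition d_z :: "'n \<Rightarrow> (complex ^ 'n \<Rightarrow> complex) \<Rightarrow> complex ^ 'n \<Rightarrow> complex" where
  "d_z j f z = (dir_deriv (axis j 1) f z - \<i> * dir_deriv (axis j \<i>) f z) / 2"

definition d_zbar :: "'n \<Rightarrow> (complex ^ 'n \<Rightarrow> complex) \<Rightarrow> complex ^ 'n \<Rightarrow> complex" where
  "d_zbar k f z = (dir_deriv (axis k 1) f z + \<i> * dir_deriv (axis k \<i>) f z) / 2"

text \<open>The Hermitean form with potential \<open>log (kdiag K)\<close> at the point \<open>z\<close>, evaluated at the tangent
  vectors \<open>u\<close> and \<open>v\<close>; \<open>dz\<^sub>j \<otimes> dzbar\<^sub>k\<close> sends \<open>(u, v)\<close> to \<open>u\<^sub>j\<close> times the conjugate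
  of \<open>v\<^sub>k\<close>.\<close>

definition sigma_form :: "'n kernel \<Rightarrow> complex ^ 'n \<Rightarrow> complex ^ 'n \<Rightarrow> complex ^ 'n \<Rightarrow> complex" where
  "sigma_form K z u v =
     (\<Sum>j\<in>UNIV. \<Sum>k\<in>UNIV.
        d_z j (d_zbar k (\<lambda>w. complex_of_real (ln (kdiag K w)))) z * (u $ j * cnj (v $ k)))"


definition delta1 :: "'n kernel \<Rightarrow> complex ^ 'n \<Rightarrow> complex ^ 'n \<Rightarrow> real" where
  "delta1 K x y = sqrt (1 - (cmod (K x y))\<^sup>2 / (kdiag K x * kdiag K y))"

definition delta2 :: "'n kernel \<Rightarrow> complex ^ 'n \<Rightarrow> complex ^ 'n \<Rightarrow> real" where
  "delta2 K x y = sqrt (2 - 2 * (cmod (K x y) / sqrt (kdiag K x * kdiag K y)))"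

end

theory Submission
  imports Defs "HOL-Complex_Analysis.Complex_Analysis"
begin

text \<open>Everything is reduced to one identity with a fixed base point \<open>p\<close>,
  \<open>L x y * K x p * K p y * L p p = K x y * L x p * L p y * K p p\<close>.
  Both sides are holomorphic in \<open>x\<close> and antiholomorphic in \<open>y\<close>, so the identity spreads from a
  neighbourhood of \<open>p\<close> to all of \<open>X\<close>, and there it gives \<open>L x y = \<omega> x * cnj (\<omega> y) * K x y\<close> with
  \<open>\<omega> x\<close> proportional to \<open>L x p / K x p\<close> on the dense set where \<open>K x p \<noteq> 0\<close>.

  Equality of the normalised moduli makes the quotient of the two sides a unimodular holomorphic
  function of \<open>x\<close> near \<open>p\<close>, hence constant. Equality of the forms says that the mixed derivatives
  of \<open>log (L x y / K x y)\<close> vanish on the diagonal, hence by polarisation everywhere near \<open>(p, p)\<close>, so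
  that this logarithm splits into a function of \<open>x\<close> and a function of \<open>y\<close>.

  The argument for the forms needs \<open>K\<close> to be jointly regular, while only separate holomorphy
  is assumed; this is Hartogs' theorem.\<close>

section \<open>Osgood's lemma and the identity theorem\<close>

text \<open>Separate holomorphy gives no joint bound, and Osgood's lemma needs one. Baire's theorem
  yields a bound only on a product with a possibly tiny first factor, so the Taylor coefficients in
  \<open>x\<close> are bounded uniformly in \<open>y\<close> at a poor geometric rate; the good rate
  holds for each \<open>y\<close> with a constant depending on \<open>y\<close>. The classical
  bridge is Hartogs' lemma on subharmonic functions. Here a finite count replaces it: sets of
  \<open>y\<close> with a common constant exhaust a ball, so one of them misses little measure,
  hence some circle about each nearby centre has most of its \<open>N\<close> equidistant points in
  it, and the maximum principle bounds the value at the centre by a geometric mean over these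
  points. The other obstacle is that \<open>K x p\<close> may vanish, so that
  \<open>L x p / K x p\<close> does not define \<open>\<omega>\<close> everywhere. At such
  \<open>x\<close> the value is read off from an auxiliary point \<open>q x\<close> with
  \<open>K x (q x) \<noteq> 0\<close>, and continuity carries the identity over from the dense set.
  Since \<open>\<omega>\<close> comes without any regularity, the passage from a rescaling to the
  forms never differentiates it.\<close>

lemma Cauchy_deriv_bound:
  assumes g: "g holomorphic_on ball a r" and C: "\<And>z. z \<in> ball a r \<Longrightarrow> cmod (g z) \<le> C"
    and s: "0 < s" "ball x s \<subseteq> ball a r"
  shows "cmod ((deriv ^^ n) g x) \<le> fact n * C / (s/2)^n"
proof (rule Cauchy_inequality)
  \<comment> \<open>Cauchy's inequality wants a closed disc on which \<open>g\<close> is continuous;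
    halving the radius provides it and is the origin of the powers of 2 in the later
    constants.\<close>
  have sub: "cball x (s/2) \<subseteq> ball a r"
    using s by (auto simp: subset_iff)
  show "g holomorphic_on ball x (s/2)"
    by (rule holomorphic_on_subset[OF g]) (use sub ball_subset_cball in blast)
  show "continuous_on (cball x (s/2)) g"
    by (rule continuous_on_subset[OF holomorphic_on_imp_continuous_on[OF g] sub])
  show "0 < s/2" using s by simp
  show "cmod (g y) \<le> C" if "cmod (x - y) = s/2" for y
    by (rule C) (use sub that in \<open>auto simp: dist_norm subset_iff\<close>)
qed

text \<open>Each point of \<open>ball a (r/2)\<close> is the centre of a disc of radius
  \<open>r/2\<close> inside the domain. Cauchy's estimate halves this once more, so
  \<open>|g'| \<le> C / (r/4)\<close>.\<close>

lemma bounded_holomorphic_lipschitz: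
  assumes g: "g holomorphic_on ball a r" and C: "\<And>z. z \<in> ball a r \<Longrightarrow> cmod (g z) \<le> C"
    and h: "cmod h < r/2"
  shows "cmod (g (a + h) - g a) \<le> 4 * C / r * cmod h"
proof -
  have r: "r > 0" using h by (smt (verit) norm_ge_zero field_sum_of_halves)
  have "cmod (g (a+h) - g a) \<le> 4 * C / r * cmod (a + h - a)"
  proof (rule field_differentiable_bound[where S="ball a (r/2)" and f' = "deriv g"])
    fix z assume z: "z \<in> ball a (r/2)"
    then have "z \<in> ball a r" using r by auto
    then show "(g has_field_derivative deriv g z) (at z within ball a (r/2))"
      using g holomorphic_derivI has_field_derivative_at_within by blast
    have "ball z (r/2) \<subseteq> ball a r"
      using z by (auto simp: dist_norm subset_iff) (smt (verit) norm_triangle_ineq4 field_sum_of_halves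
        dist_norm dist_triangle dist_commute)
    from Cauchy_deriv_bound[OF g C _ this, of 1] r
    show "cmod (deriv g z) \<le> 4 * C / r" by (simp add: mult.commute)
  qed (use h r in \<open>auto simp: dist_norm\<close>)
  then show ?thesis by simp
qed

text \<open>The constant is \<open>32 = 2! * 4^2\<close>: Cauchy's estimate for the second
  derivative at radius \<open>r/4\<close>. The remainder term of \<open>complex_Taylor\<close>
  divides by \<open>fact 1\<close> only.\<close>

lemma bounded_holomorphic_taylor2:
  assumes g: "g holomorphic_on ball a r" and C: "\<And>z. z \<in> ball a r \<Longrightarrow> cmod (g z) \<le> C"
    and h: "cmod h < r/2"
  shows "cmod (g (a + h) - g a - h * deriv g a) \<le> 32 * C / r\<^sup>2 * (cmod h)\<^sup>2"
proof -
  have r: "r > 0" using h by (smt (verit) norm_ge_zero field_sum_of_halves)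
  have "cmod ((deriv ^^ 0) g (a+h) - (\<Sum>i\<le>1. (deriv ^^ i) g a * (a + h - a) ^ i / fact i))
      \<le> 32 * C / r\<^sup>2 * cmod (a + h - a) ^ (Suc 1) / fact 1"
  proof (rule complex_Taylor[where S="ball a (r/2)" and n=1 and f = "\<lambda>i. (deriv ^^ i) g"])
    fix z assume z: "z \<in> ball a (r/2)"
    then have za: "z \<in> ball a r" using r by auto
    have "ball z (r/2) \<subseteq> ball a r"
      using z by (auto simp: dist_norm subset_iff) (smt (verit) norm_triangle_ineq4 field_sum_of_halves
        dist_norm dist_triangle dist_commute)
    from Cauchy_deriv_bound[OF g C _ this, of 2] r
    show "cmod ((deriv ^^ Suc 1) g z) \<le> 32 * C / r\<^sup>2"
      by (simp add: numeral_2_eq_2 power2_eq_square field_simps)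
    fix i :: nat
    have "(deriv ^^ i) g holomorphic_on ball a r"
      by (intro holomorphic_higher_deriv g) auto
    then show "((deriv ^^ i) g has_field_derivative (deriv ^^ Suc i) g z) (at z within ball a (r/2))"
      using za holomorphic_derivI[of _ "ball a r"] has_field_derivative_at_within by simp
  qed (use h r in \<open>auto simp: dist_norm\<close>)
  then show ?thesis by (simp add: numeral_2_eq_2 algebra_simps)
qed

text \<open>Difference quotients in \<open>\<zeta>\<close> are holomorphic in \<open>\<eta>\<close>,
  and their second-order error depends on \<open>C\<close> and \<open>r\<close> alone, so they
  converge uniformly in \<open>\<eta>\<close>. The common bound \<open>C\<close> does the work
  usually done by joint continuity.\<close>

lemma holomorphic_deriv_parameter:
  assumes T: "open T" and r: "0 < r"
    and bd: "\<And>\<zeta> \<eta>. \<zeta> \<in> ball a r \<Longrightarrow> \<eta> \<in> T \<Longrightarrow> cmod (\<Phi> \<zeta> \<eta>) \<le> C"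
    and h1: "\<And>\<eta>. \<eta> \<in> T \<Longrightarrow> (\<lambda>\<zeta>. \<Phi> \<zeta> \<eta>) holomorphic_on ball a r"
    and h2: "\<And>\<zeta>. \<zeta> \<in> ball a r \<Longrightarrow> (\<lambda>\<eta>. \<Phi> \<zeta> \<eta>) holomorphic_on T"
  shows "(\<lambda>\<eta>. deriv (\<lambda>\<zeta>. \<Phi> \<zeta> \<eta>) a) holomorphic_on T"
proof -
  \<comment> \<open>Even the first step is \<open>r/4\<close>, below the limit \<open>r/2\<close> of
    the Taylor estimate.\<close>
  define t :: "nat \<Rightarrow> real" where "t n = r / (4 * real (Suc n))" for n
  have t0: "0 < t n" "t n \<le> r/4" for n using r by (auto simp: t_def field_simps)
  have tlim: "t \<longlonglongrightarrow> 0"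
  proof -
    have "(\<lambda>n. r/4 * (1 / real (Suc n))) \<longlonglongrightarrow> r/4 * 0"
      by (intro tendsto_intros LIMSEQ_Suc lim_1_over_n)
    then show ?thesis by (simp add: t_def[abs_def])
  qed
  define q where "q n \<eta> = (\<Phi> (a + t n) \<eta> - \<Phi> a \<eta>) / t n" for n \<eta>
  have est: "cmod (q n \<eta> - deriv (\<lambda>\<zeta>. \<Phi> \<zeta> \<eta>) a) \<le> 32 * C / r\<^sup>2 * t n" if "\<eta> \<in> T" for n \<eta>
  proof -
    have "cmod (\<Phi> (a + t n) \<eta> - \<Phi> a \<eta> - t n * deriv (\<lambda>\<zeta>. \<Phi> \<zeta> \<eta>) a) \<le> 32 * C / r\<^sup>2 * (cmod (t n))\<^sup>2"
      by (rule bounded_holomorphic_taylor2[OF h1[OF that] bd[OF _ that]])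
         (use t0[of n] r in auto)
    then have "cmod (\<Phi> (a + t n) \<eta> - \<Phi> a \<eta> - t n * deriv (\<lambda>\<zeta>. \<Phi> \<zeta> \<eta>) a) / t n \<le> 32 * C / r\<^sup>2 * t n"
      using t0[of n] by (simp add: field_simps power2_eq_square)
    moreover have "cmod (q n \<eta> - deriv (\<lambda>\<zeta>. \<Phi> \<zeta> \<eta>) a)
        = cmod ((\<Phi> (a + t n) \<eta> - \<Phi> a \<eta> - t n * deriv (\<lambda>\<zeta>. \<Phi> \<zeta> \<eta>) a) / complex_of_real (t n))"
      using t0[of n] by (simp add: q_def field_simps)
    ultimately show ?thesis
      using t0[of n] by (simp add: norm_divide)
  qed
  show ?thesis
  proof (rule holomorphic_uniform_sequence[OF T])
    show "q n holomorphic_on T" for n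
    proof -
      have "a + t n \<in> ball a r" using t0[of n] r by (auto simp: dist_norm)
      then show ?thesis unfolding q_def
        using t0[of n] r by (intro holomorphic_intros h2) auto
    qed
    fix x assume "x \<in> T"
    then obtain d where d: "d > 0" "cball x d \<subseteq> T"
      using T open_contains_cball by blast
    have "uniform_limit (cball x d) q (\<lambda>\<eta>. deriv (\<lambda>\<zeta>. \<Phi> \<zeta> \<eta>) a) sequentially"
    proof (rule uniform_limitI)
      fix e :: real assume e: "e > 0"
      have "(\<lambda>n. 32 * C / r\<^sup>2 * t n) \<longlonglongrightarrow> 32 * C / r\<^sup>2 * 0" by (intro tendsto_intros tlim)
      then have "\<forall>\<^sub>F n in sequentially. 32 * C / r\<^sup>2 * t n < e"
        using e by (simp add: order_tendsto_iff)
      then show "\<forall>\<^sub>F n in sequentially. \<forall>x\<in>cball x d. dist (q n x) (deriv (\<lambda>\<zeta>. \<Phi> \<zeta> x) a) < e"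
      proof eventually_elim
        case (elim n)
        show ?case
        proof
          fix y assume "y \<in> cball x d"
          then show "dist (q n y) (deriv (\<lambda>\<zeta>. \<Phi> \<zeta> y) a) < e"
            using est[of y n] d elim by (auto simp: dist_norm subset_iff)
        qed
      qed
    qed
    then show "\<exists>d>0. cball x d \<subseteq> T \<and> uniform_limit (cball x d) q (\<lambda>\<eta>. deriv (\<lambda>\<zeta>. \<Phi> \<zeta> \<eta>) a) sequentially"
      using d by blast
  qed
qed

text \<open>The induction replaces \<open>\<Phi>\<close> by its \<open>\<zeta>\<close>-derivative.
  Boundedness is asked only locally in \<open>\<zeta>\<close> because Cauchy's estimate for the
  derivative shrinks the disc, and a local bound survives that.\<close>

lemma holomorphic_higher_deriv_parameter:
  assumes S: "open S" and T: "open T"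
    and bd: "\<And>a. a \<in> S \<Longrightarrow> \<exists>e>0. \<exists>C. ball a e \<subseteq> S \<and> (\<forall>\<zeta>\<in>ball a e. \<forall>\<eta>\<in>T. cmod (\<Phi> \<zeta> \<eta>) \<le> C)"
    and h1: "\<And>\<eta>. \<eta> \<in> T \<Longrightarrow> (\<lambda>\<zeta>. \<Phi> \<zeta> \<eta>) holomorphic_on S"
    and h2: "\<And>\<zeta>. \<zeta> \<in> S \<Longrightarrow> (\<lambda>\<eta>. \<Phi> \<zeta> \<eta>) holomorphic_on T"
    and a: "a \<in> S"
  shows "(\<lambda>\<eta>. (deriv ^^ k) (\<lambda>\<zeta>. \<Phi> \<zeta> \<eta>) a) holomorphic_on T"
  using bd h1 h2 a
proof (induction k arbitrary: \<Phi> a)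
  case 0
  then show ?case by simp
next
  case (Suc k)
  define \<Psi> where "\<Psi> \<zeta> \<eta> = deriv (\<lambda>\<zeta>. \<Phi> \<zeta> \<eta>) \<zeta>" for \<zeta> \<eta>
  have "(\<lambda>\<eta>. (deriv ^^ k) (\<lambda>\<zeta>. \<Psi> \<zeta> \<eta>) a) holomorphic_on T"
  proof (rule Suc.IH)
    show "a \<in> S" by fact
    show "(\<lambda>\<zeta>. \<Psi> \<zeta> \<eta>) holomorphic_on S" if "\<eta> \<in> T" for \<eta>
      unfolding \<Psi>_def by (intro holomorphic_deriv Suc.prems(2) that S)
    fix b assume b: "b \<in> S"
    from Suc.prems(1)[OF b] obtain e C where e: "e > 0" "ball b e \<subseteq> S"
      and C: "\<And>\<zeta> \<eta>. \<zeta>\<in>ball b e \<Longrightarrow> \<eta>\<in>T \<Longrightarrow> cmod (\<Phi> \<zeta> \<eta>) \<le> C" by blast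
    have hb: "(\<lambda>\<zeta>. \<Phi> \<zeta> \<eta>) holomorphic_on ball b e" if "\<eta> \<in> T" for \<eta>
      using Suc.prems(2)[OF that] e holomorphic_on_subset by blast
    show "(\<lambda>\<eta>. \<Psi> b \<eta>) holomorphic_on T"
      unfolding \<Psi>_def
      by (rule holomorphic_deriv_parameter[OF T e(1) C hb]) (use e Suc.prems(3) in auto)
    have "cmod (\<Psi> \<zeta> \<eta>) \<le> 4 * C / e" if "\<zeta> \<in> ball b (e/2)" "\<eta> \<in> T" for \<zeta> \<eta>
    proof -
      have "ball \<zeta> (e/2) \<subseteq> ball b e"
        using that(1) by (auto simp: subset_iff) (smt (verit) dist_triangle field_sum_of_halves)
      from Cauchy_deriv_bound[OF hb[OF that(2)] C[OF _ that(2)] _ this, of 1] e(1)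
      show ?thesis by (simp add: \<Psi>_def mult.commute)
    qed
    then show "\<exists>e>0. \<exists>C. ball b e \<subseteq> S \<and> (\<forall>\<zeta>\<in>ball b e. \<forall>\<eta>\<in>T. cmod (\<Psi> \<zeta> \<eta>) \<le> C)"
      using e by (intro exI[of _ "e/2"] conjI exI[of _ "4 * C / e"]) auto
  qed
  then show ?case
    by (simp add: \<Psi>_def funpow_swap1)
qed

section \<open>Separately holomorphic functions and Osgood's lemma\<close>

definition coord_holomorphic_on :: "(complex ^ 'm \<Rightarrow> complex) \<Rightarrow> (complex ^ 'm) set \<Rightarrow> bool" where
  "coord_holomorphic_on f \<Omega> \<longleftrightarrow>
     (\<forall>z\<in>\<Omega>. \<forall>k. (\<lambda>\<zeta>. f (z + axis k \<zeta>)) field_differentiable (at 0))"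

definition locally_bounded_on :: "(complex ^ 'm \<Rightarrow> complex) \<Rightarrow> (complex ^ 'm) set \<Rightarrow> bool" where
  "locally_bounded_on f \<Omega> \<longleftrightarrow> (\<forall>z\<in>\<Omega>. \<exists>e>0. \<exists>C. \<forall>w\<in>ball z e. cmod (f w) \<le> C)"

definition pd :: "'m \<Rightarrow> (complex ^ 'm \<Rightarrow> complex) \<Rightarrow> complex ^ 'm \<Rightarrow> complex" where
  "pd k f z = deriv (\<lambda>\<zeta>. f (z + axis k \<zeta>)) 0"

lemma norm_axis_complex [simp]: "norm (axis k (\<zeta>::complex)) = cmod \<zeta>"
  by (simp add: norm_vec_def axis_def L2_set_def if_distrib[of norm] if_distrib[of "\<lambda>x. x\<^sup>2"] 
      cong: if_cong)

lemma axis_0 [simp]: "axis k (0::complex) = 0"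
  by (simp add: vec_eq_iff axis_def)

lemma axis_add_complex: "axis k (a + b) = axis k a + axis k (b::complex)"
  by (simp add: vec_eq_iff axis_def)

lemma axis_smult: "axis k (\<zeta>::complex) = \<zeta> *s axis k 1"
  by (simp add: vec_eq_iff axis_def)

lemma coord_holomorphic_line:
  assumes f: "coord_holomorphic_on f \<Omega>" and U: "\<And>\<zeta>. \<zeta> \<in> U \<Longrightarrow> z + axis k \<zeta> \<in> \<Omega>"
  shows "(\<lambda>\<zeta>. f (z + axis k \<zeta>)) holomorphic_on U"
proof -
  have "(\<lambda>\<zeta>. f (z + axis k \<zeta>)) field_differentiable (at \<zeta>)" if "\<zeta> \<in> U" for \<zeta>
  proof -
    have "(\<lambda>h. f ((z + axis k \<zeta>) + axis k h)) field_differentiable (at 0)"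
      using f U[OF that] by (auto simp: coord_holomorphic_on_def)
    then obtain d where "((\<lambda>h. f ((z + axis k \<zeta>) + axis k h)) has_field_derivative d) (at 0)"
      by (auto simp: field_differentiable_def)
    then have "((\<lambda>h. f (z + axis k (\<zeta> + h))) has_field_derivative d) (at 0)"
      by (simp add: axis_add_complex add.assoc)
    then have "((\<lambda>\<zeta>. f (z + axis k \<zeta>)) has_field_derivative d) (at (0 + \<zeta>))"
      by (subst DERIV_shift) (simp add: add.commute)
    then show ?thesis by (auto simp: field_differentiable_def)
  qed
  then show ?thesis
    by (auto simp: holomorphic_on_def field_differentiable_at_within)
qed

lemma has_derivative_at_quadratic:
  fixes f :: "'a::real_normed_vector \<Rightarrow> 'b::real_normed_vector"
  assumes D: "bounded_linear D" and d: "0 < d"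
    and M: "\<And>h. norm h < d \<Longrightarrow> norm (f (z + h) - f z - D h) \<le> M * (norm h)\<^sup>2"
  shows "(f has_derivative D) (at z)"
  unfolding has_derivative_at
proof (intro conjI D)
  have "((\<lambda>h::'a. \<bar>M\<bar> * norm h) \<longlongrightarrow> \<bar>M\<bar> * norm (0::'a)) (at 0)"
    by (intro tendsto_mult tendsto_const tendsto_norm tendsto_ident_at)
  then have lim: "((\<lambda>h::'a. \<bar>M\<bar> * norm h) \<longlongrightarrow> 0) (at 0)" unfolding norm_zero mult_zero_right .
  show "(\<lambda>h. norm (f (z + h) - f z - D h) / norm h) \<midarrow>0\<rightarrow> 0"
  proof (rule Lim_null_comparison[OF _ lim])
    have "\<forall>\<^sub>F h in at 0. norm h < d \<and> h \<noteq> 0"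
      using d by (auto simp: eventually_at dist_norm)
    then show "\<forall>\<^sub>F h in at 0. norm (norm (f (z + h) - f z - D h) / norm h) \<le> \<bar>M\<bar> * norm h"
    proof eventually_elim
      case (elim h)
      have "norm (f (z + h) - f z - D h) \<le> \<bar>M\<bar> * (norm h)\<^sup>2"
        by (rule order_trans[OF M]) (use elim in \<open>auto intro: mult_right_mono\<close>)
      then show ?case using elim by (simp add: field_simps power2_eq_square)
    qed
  qed
qed

text \<open>The points \<open>z + restr S h\<close> are the corners of a path from \<open>z\<close>
  to \<open>z + h\<close> that changes one coordinate at a time; estimates along it go by induction
  on the finite set \<open>S\<close>.\<close>

definition restr :: "'m set \<Rightarrow> complex ^ 'm \<Rightarrow> complex ^ 'm" where
  "restr S h = (\<chi> k. if k \<in> S then h $ k else 0)"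

lemma restr_simps [simp]: "restr {} h = 0" "restr UNIV h = h"
  by (simp_all add: restr_def vec_eq_iff)

lemma restr_insert: "k \<notin> S \<Longrightarrow> restr (insert k S) h = restr S h + axis k (h $ k)"
  by (auto simp: restr_def vec_eq_iff axis_def)

lemma norm_restr: "norm (restr S h) \<le> norm h"
  unfolding norm_vec_def by (rule L2_set_mono) (auto simp: restr_def)

text \<open>Along the coordinate path each step has a quadratic one-variable Taylor error, but with
  the partial derivative taken at a corner. Moving that derivative back to \<open>z\<close> costs a
  factor \<open>O(norm h)\<close>, so the total error is quadratic in \<open>norm h\<close> and the
  derivative is the sum of the partial ones.\<close>

theorem osgood:
  fixes f :: "complex ^ 'm \<Rightarrow> complex"
  assumes \<Omega>: "open \<Omega>" and f: "coord_holomorphic_on f \<Omega>" and lb: "locally_bounded_on f \<Omega>"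
  shows "holomorphic_on_vec f \<Omega>"
  unfolding holomorphic_on_vec_def
proof
  fix z assume z: "z \<in> \<Omega>"
  obtain e C where e: "e > 0" and C: "\<And>w. w \<in> ball z e \<Longrightarrow> cmod (f w) \<le> C"
    using lb z unfolding locally_bounded_on_def by blast
  obtain e' where e': "e' > 0" "ball z e' \<subseteq> \<Omega>"
    using \<Omega> z open_contains_ball by blast
  \<comment> \<open>A quarter, so that a disc of radius \<open>2*r\<close> about a point within
    \<open>2*r\<close> of \<open>z\<close> stays in the region where \<open>f\<close> is
    bounded.\<close>
  define r where "r = min e e' / 4"
  have r: "r > 0" using e e' by (simp add: r_def)
  have ball: "ball z (4*r) \<subseteq> \<Omega>" "\<And>w. w \<in> ball z (4*r) \<Longrightarrow> cmod (f w) \<le> C"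
    using e' C by (auto simp: r_def)
  have C0: "0 \<le> C" using ball(2)[of z] r by (smt (verit) centre_in_ball norm_ge_zero)
  define L where "L = 2 * C / r"
  have L0: "L \<ge> 0" using C0 r by (simp add: L_def)
  have hol: "(\<lambda>\<zeta>. f (w + axis k \<zeta>)) holomorphic_on ball 0 (2*r)" if "norm (w - z) < 2 * r" for w k
  proof (rule coord_holomorphic_line[OF f])
    fix \<zeta> :: complex assume "\<zeta> \<in> ball 0 (2*r)"
    then have "norm (w + axis k \<zeta> - z) < 4 * r"
      using that norm_triangle_ineq[of "w - z" "axis k \<zeta>"] by (simp add: algebra_simps)
    then show "w + axis k \<zeta> \<in> \<Omega>" using ball(1) by (auto simp: dist_norm norm_minus_commute)
  qed
  have bnd: "cmod (f (w + axis k \<zeta>)) \<le> C" if "norm (w - z) < 2 * r" "\<zeta> \<in> ball 0 (2*r)" for w k \<zeta>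
  proof (rule ball(2))
    have "norm (w + axis k \<zeta> - z) < 4 * r"
      using that norm_triangle_ineq[of "w - z" "axis k \<zeta>"] by (simp add: algebra_simps)
    then show "w + axis k \<zeta> \<in> ball z (4*r)" by (auto simp: dist_norm norm_minus_commute)
  qed
  have lip1: "cmod (f (w + axis k \<zeta>) - f w) \<le> L * cmod \<zeta>" if "norm (w - z) < 2 * r" "cmod \<zeta> < r" for w k \<zeta>
    using bounded_holomorphic_lipschitz[OF hol[OF that(1), of k] bnd[OF that(1), of _ k], of \<zeta>] that
    by (simp add: L_def)
  have tay1: "cmod (f (w + axis k \<zeta>) - f w - \<zeta> * pd k f w) \<le> 8 * C / r\<^sup>2 * (cmod \<zeta>)\<^sup>2"
    if "norm (w - z) < 2 * r" "cmod \<zeta> < r" for w k \<zeta>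
    using bounded_holomorphic_taylor2[OF hol[OF that(1), of k] bnd[OF that(1), of _ k], of \<zeta>] that
    by (simp add: pd_def power_mult_distrib)
  have lip: "cmod (f (w + restr S h) - f w) \<le> L * card S * norm h"
    if w: "norm (w - z) < r" and h: "norm h < r" for w h and S :: "'m set"
    using finite[of S]
  proof (induction S rule: finite_induct)
    case (insert k S)
    have "norm (w + restr S h - z) < 2 * r"
      using w h norm_triangle_ineq[of "w - z" "restr S h"] norm_restr[of S h] by (simp add: algebra_simps)
    then have "cmod (f (w + restr S h + axis k (h $ k)) - f (w + restr S h)) \<le> L * cmod (h $ k)"
      by (rule lip1) (use h Finite_Cartesian_Product.norm_nth_le[of h k] in simp)
    also have "\<dots> \<le> L * norm h"
      by (intro mult_left_mono L0 Finite_Cartesian_Product.norm_nth_le)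
    finally have "cmod (f (w + restr (insert k S) h) - f w) \<le> L * norm h + L * card S * norm h"
      using insert.IH norm_triangle_ineq[of "f (w + restr S h + axis k (h $ k)) - f (w + restr S h)" "f (w + restr S h) - f w"]
      by (simp add: restr_insert[OF insert(2)] add.assoc)
    then show ?case using insert by (simp add: algebra_simps)
  qed simp
  define N where "N = real CARD('m)"
  have N0: "N \<ge> 0" by (simp add: N_def)
  have lipU: "cmod (f (w + restr S h) - f w) \<le> L * N * norm h"
    if w: "norm (w - z) < r" and h: "norm h < r" for w h and S :: "'m set"
    by (rule order_trans[OF lip[OF that]]) (auto simp: N_def intro!: mult_right_mono mult_left_mono L0 card_mono)
  have pdlip: "cmod (pd k f (z + restr S h) - pd k f z) \<le> 2 * (L * N * norm h) / r"
    if h: "norm h < r" for h k and S :: "'m set"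
  proof -
    \<comment> \<open>The two slices differ by at most \<open>L * N * norm h\<close> on a whole
      disc, so Cauchy's estimate bounds the difference of their derivatives at 0: the partial
      derivatives are Lipschitz at \<open>z\<close> although nothing is known yet about their
      continuity.\<close>
    define G where "G \<zeta> = f (z + restr S h + axis k \<zeta>) - f (z + axis k \<zeta>)" for \<zeta>
    have n1: "norm (z + restr S h - z) < 2 * r" using norm_restr[of S h] h r by simp
    have n2: "norm (z - z) < 2 * r" using r by simp
    have G1: "G holomorphic_on ball 0 r"
      unfolding G_def
      by (intro holomorphic_intros holomorphic_on_subset[OF hol[OF n1]] holomorphic_on_subset[OF hol[OF n2]])
         (use r in auto)
    have G2: "cmod (G \<zeta>) \<le> L * N * norm h" if "\<zeta> \<in> ball 0 r" for \<zeta>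
      using lipU[of "z + axis k \<zeta>" h S] that h by (simp add: G_def algebra_simps)
    have "cmod ((deriv ^^ 1) G 0) \<le> fact 1 * (L * N * norm h) / (r / 2) ^ 1"
      by (rule Cauchy_deriv_bound[OF G1 G2]) (use r in auto)
    moreover have "deriv G 0 = pd k f (z + restr S h) - pd k f z"
      unfolding G_def pd_def
      by (intro deriv_diff holomorphic_on_imp_differentiable_at[OF hol[OF n1]]
          holomorphic_on_imp_differentiable_at[OF hol[OF n2]]) (use r in auto)
    ultimately show ?thesis by (simp add: mult.commute)
  qed
  \<comment> \<open>The first summand is the Taylor error of one step, the second the cost of
    replacing the partial derivative at a corner by the one at \<open>z\<close>.\<close>
  define M where "M = 8 * C / r\<^sup>2 + 2 * L * N / r"
  have tay: "cmod (f (z + restr S h) - f z - (\<Sum>k\<in>S. h $ k * pd k f z)) \<le> card S * M * (norm h)\<^sup>2"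
    if h: "norm h < r" for h and S :: "'m set"
    using finite[of S]
  proof (induction S rule: finite_induct)
    case (insert k S)
    have hk: "cmod (h $ k) \<le> norm h" by (rule Finite_Cartesian_Product.norm_nth_le)
    have "cmod (f (z + restr S h + axis k (h $ k)) - f (z + restr S h) - h $ k * pd k f (z + restr S h))
        \<le> 8 * C / r\<^sup>2 * (cmod (h $ k))\<^sup>2"
      by (rule tay1) (use h hk r norm_restr[of S h] in auto)
    also have "\<dots> \<le> 8 * C / r\<^sup>2 * (norm h)\<^sup>2"
      by (intro mult_left_mono power_mono hk) (use C0 in auto)
    finally have a: "cmod (f (z + restr (insert k S) h) - f (z + restr S h) - h $ k * pd k f (z + restr S h))
        \<le> 8 * C / r\<^sup>2 * (norm h)\<^sup>2" by (simp add: restr_insert[OF insert(2)] add.assoc)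
    have "cmod (h $ k * pd k f (z + restr S h) - h $ k * pd k f z) \<le> norm h * (2 * (L * N * norm h) / r)"
      unfolding right_diff_distrib[symmetric] norm_mult by (intro mult_mono hk pdlip h) auto
    then have b: "cmod (h $ k * pd k f (z + restr S h) - h $ k * pd k f z) \<le> 2 * L * N / r * (norm h)\<^sup>2"
      by (simp add: power2_eq_square mult_ac)
    define A where "A = f (z + restr (insert k S) h) - f (z + restr S h) - h $ k * pd k f (z + restr S h)"
    define B where "B = h $ k * pd k f (z + restr S h) - h $ k * pd k f z"
    define D where "D = f (z + restr S h) - f z - (\<Sum>k\<in>S. h $ k * pd k f z)"
    have "f (z + restr (insert k S) h) - f z - (\<Sum>k\<in>insert k S. h $ k * pd k f z) = A + B + D"
      using insert by (simp add: A_def B_def D_def)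
    moreover have "cmod (A + B + D) \<le> cmod A + cmod B + cmod D"
      using norm_triangle_ineq[of "A+B" D] norm_triangle_ineq[of A B] by linarith
    moreover have "cmod A + cmod B \<le> M * (norm h)\<^sup>2"
      using a b unfolding A_def[symmetric] B_def[symmetric] M_def distrib_right by linarith
    moreover have "cmod D \<le> card S * M * (norm h)\<^sup>2"
      using insert.IH unfolding D_def .
    moreover have "real (card (insert k S)) * M * (norm h)\<^sup>2 = M * (norm h)\<^sup>2 + card S * M * (norm h)\<^sup>2"
      using insert(1,2) by (simp add: distrib_right)
    ultimately show ?case by simp
  qed simp
  have "(f has_derivative (\<lambda>h. \<Sum>k\<in>UNIV. h $ k * pd k f z)) (at z)"
  proof (rule has_derivative_at_quadratic[OF _ r, where M = "N * M"])
    show "bounded_linear (\<lambda>h. \<Sum>k\<in>UNIV. h $ k * pd k f z)"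
      by (intro bounded_linear_sum bounded_linear_mult_const bounded_linear_vec_nth)
    fix h :: "complex ^ 'm" assume "norm h < r"
    from tay[OF this, of UNIV]
    show "cmod (f (z + h) - f z - (\<Sum>k\<in>UNIV. h $ k * pd k f z)) \<le> N * M * (norm h)\<^sup>2" by (simp add: N_def)
  qed
  then show "\<exists>f'. (f has_derivative f') (at z) \<and> (\<forall>c v. f' (c *s v) = c * f' v)"
    by (intro exI[of _ "\<lambda>h. \<Sum>k\<in>UNIV. h $ k * pd k f z"]) (auto simp: sum_distrib_left mult.assoc)
qed

lemma holomorphic_on_vec_subset: "holomorphic_on_vec f \<Omega> \<Longrightarrow> \<Omega>' \<subseteq> \<Omega> \<Longrightarrow> holomorphic_on_vec f \<Omega>'"
  by (auto simp: holomorphic_on_vec_def)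

lemma smult_of_real: "complex_of_real t *s v = t *\<^sub>R v"
  by (simp add: vec_eq_iff scaleR_conv_of_real[where 'a=complex])

lemma bounded_linear_smult_left: "bounded_linear (\<lambda>\<zeta>::complex. \<zeta> *s (v :: complex ^ 'm))"
proof -
  have "linear (\<lambda>\<zeta>::complex. \<zeta> *s (v :: complex ^ 'm))"
    by (rule linearI) (simp_all add: vec_eq_iff algebra_simps)
  then show ?thesis by (simp add: linear_conv_bounded_linear)
qed

lemma norm_smult: "norm ((c::complex) *s v) = cmod c * norm v"
  by (simp add: norm_vec_def norm_mult L2_set_right_distrib)

lemma holomorphic_on_vec_imp_continuous: "holomorphic_on_vec f \<Omega> \<Longrightarrow> continuous_on \<Omega> f"
  unfolding holomorphic_on_vec_def
  by (rule continuous_at_imp_continuous_on) (auto dest: has_derivative_continuous)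

lemma has_field_derivative_along_line:
  fixes f :: "complex ^ 'm \<Rightarrow> complex"
  assumes f': "(f has_derivative f') (at (a + \<zeta> *s v))" and lin: "\<And>c v. f' (c *s v) = c * f' v"
  shows "((\<lambda>\<zeta>. f (a + \<zeta> *s v)) has_field_derivative f' v) (at \<zeta>)"
proof -
  have "((\<lambda>\<zeta>. a + \<zeta> *s v) has_derivative (\<lambda>h. h *s v)) (at \<zeta>)"
  proof -
    have "((\<lambda>\<zeta>. a + \<zeta> *s v) has_derivative (\<lambda>h. 0 + h *s v)) (at \<zeta>)"
      by (intro has_derivative_add has_derivative_const bounded_linear_imp_has_derivative bounded_linear_smult_left)
    then show ?thesis by (simp only: add_0_left)
  qed
  from has_derivative_compose[OF this f'] 
  have "((\<lambda>\<zeta>. f (a + \<zeta> *s v)) has_derivative (\<lambda>h. f' (h *s v))) (at \<zeta>)" .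
  then show ?thesis by (simp add: has_field_derivative_def lin mult.commute[of _ "f' v"])
qed

lemma holomorphic_on_vec_derivative:
  fixes f :: "complex ^ 'm \<Rightarrow> complex"
  assumes f: "holomorphic_on_vec f \<Omega>" and z: "z \<in> \<Omega>"
  shows "(f has_derivative (\<lambda>h. \<Sum>k\<in>UNIV. h $ k * pd k f z)) (at z)"
proof -
  obtain f' where f': "(f has_derivative f') (at z)" and lin: "\<And>c v. f' (c *s v) = c * f' v"
    using f z by (auto simp: holomorphic_on_vec_def)
  interpret f': bounded_linear f' using f' by (rule has_derivative_bounded_linear)
  have pd: "pd k f z = f' (axis k 1)" for k
  proof -
    have "((\<lambda>\<zeta>. f (z + \<zeta> *s axis k 1)) has_field_derivative f' (axis k 1)) (at 0)"
      by (rule has_field_derivative_along_line) (use f' lin in auto)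
    then have "((\<lambda>\<zeta>. f (z + axis k \<zeta>)) has_field_derivative f' (axis k 1)) (at 0)"
      by (simp only: axis_smult[symmetric])
    then show ?thesis unfolding pd_def by (rule DERIV_imp_deriv)
  qed
  have "f' h = (\<Sum>k\<in>UNIV. h $ k * f' (axis k 1))" for h
  proof -
    have "f' h = f' (\<Sum>k\<in>UNIV. h $ k *s axis k 1)" by (simp add: basis_expansion)
    also have "\<dots> = (\<Sum>k\<in>UNIV. h $ k * f' (axis k 1))" by (simp only: f'.sum lin)
    finally show ?thesis .
  qed
  then have "f' = (\<lambda>h. \<Sum>k\<in>UNIV. h $ k * pd k f z)" unfolding pd by (rule ext)
  then show ?thesis using f' by simp
qed

lemma holomorphic_on_vec_line_derivative:
  fixes f :: "complex ^ 'm \<Rightarrow> complex"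
  assumes f: "holomorphic_on_vec f \<Omega>" and z: "a + \<zeta> *s v \<in> \<Omega>"
  shows "((\<lambda>\<zeta>. f (a + \<zeta> *s v)) has_field_derivative (\<Sum>k\<in>UNIV. v $ k * pd k f (a + \<zeta> *s v))) (at \<zeta>)"
  by (rule has_field_derivative_along_line[OF holomorphic_on_vec_derivative[OF f z]])
     (simp add: sum_distrib_left mult.assoc)

lemma holomorphic_on_vec_line:
  fixes f :: "complex ^ 'm \<Rightarrow> complex"
  assumes f: "holomorphic_on_vec f \<Omega>" and z: "\<And>\<zeta>. \<zeta> \<in> U \<Longrightarrow> a + \<zeta> *s v \<in> \<Omega>"
  shows "(\<lambda>\<zeta>. f (a + \<zeta> *s v)) holomorphic_on U"
  unfolding holomorphic_on_def
proof
  fix \<zeta> assume "\<zeta> \<in> U"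
  from holomorphic_on_vec_line_derivative[OF f z[OF this]]
  show "(\<lambda>\<zeta>. f (a + \<zeta> *s v)) field_differentiable at \<zeta> within U"
    by (auto simp: field_differentiable_def intro: has_field_derivative_at_within)
qed

lemma holomorphic_on_vec_imp_coord: "holomorphic_on_vec f \<Omega> \<Longrightarrow> coord_holomorphic_on f \<Omega>"
  unfolding coord_holomorphic_on_def
proof (intro ballI allI)
  fix z k assume "holomorphic_on_vec f \<Omega>" "z \<in> \<Omega>"
  then have "((\<lambda>\<zeta>. f (z + \<zeta> *s axis k 1)) has_field_derivative
     (\<Sum>j\<in>UNIV. axis k 1 $ j * pd j f (z + 0 *s axis k 1))) (at 0)"
    by (intro holomorphic_on_vec_line_derivative) auto
  then show "(\<lambda>\<zeta>. f (z + axis k \<zeta>)) field_differentiable at 0"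
    unfolding axis_smult[symmetric] by (auto simp: field_differentiable_def)
qed

lemma continuous_imp_locally_bounded:
  assumes "open \<Omega>" "continuous_on \<Omega> f"
  shows "locally_bounded_on f \<Omega>"
  unfolding locally_bounded_on_def
proof
  fix z assume z: "z \<in> \<Omega>"
  have "isCont f z" using assms z by (simp add: continuous_on_eq_continuous_at)
  then have "\<exists>e>0. \<forall>w. dist w z < e \<longrightarrow> dist (f w) (f z) < 1"
    unfolding continuous_at_eps_delta by (auto simp: dist_norm)
  then obtain e where e: "e > 0" "\<And>w. dist w z < e \<Longrightarrow> dist (f w) (f z) < 1" by auto
  have "cmod (f w) \<le> cmod (f z) + 1" if "w \<in> ball z e" for w
    using e(2)[of w] that norm_triangle_ineq2[of "f w" "f z"] by (auto simp: dist_norm norm_minus_commute)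
  then show "\<exists>e>0. \<exists>C. \<forall>w\<in>ball z e. cmod (f w) \<le> C" using e(1) by blast
qed

text \<open>The definition of holomorphy provides a first derivative only. Osgood's lemma applies to
  \<open>pd k f\<close>: Cauchy's estimate bounds it locally, and differentiation with a parameter
  makes it holomorphic in every other coordinate direction and in its own.\<close>

lemma holomorphic_on_vec_pd:
  fixes f :: "complex ^ 'm \<Rightarrow> complex"
  assumes \<Omega>: "open \<Omega>" and f: "holomorphic_on_vec f \<Omega>"
  shows "holomorphic_on_vec (pd k f) \<Omega>"
proof -
  note fc = holomorphic_on_vec_imp_coord[OF f]
  have loc: "\<exists>r C. r > 0 \<and> ball z (2*r) \<subseteq> \<Omega> \<and> (\<forall>w\<in>ball z (2*r). cmod (f w) \<le> C)" if z: "z \<in> \<Omega>" for z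
  proof -
    have "\<exists>e>0. \<exists>C. \<forall>w\<in>ball z e. cmod (f w) \<le> C"
      using continuous_imp_locally_bounded[OF \<Omega> holomorphic_on_vec_imp_continuous[OF f]] that
      unfolding locally_bounded_on_def by (rule bspec)
    then obtain e C where e: "e > 0" "\<forall>w\<in>ball z e. cmod (f w) \<le> C" by auto
    obtain e' where e': "e' > 0" "ball z e' \<subseteq> \<Omega>"
      using \<Omega> z open_contains_ball by blast
    show ?thesis
    proof (intro exI conjI)
      show "0 < min e e' / 2" using e e' by simp
      show "ball z (2 * (min e e' / 2)) \<subseteq> \<Omega>" using e' by auto
      show "\<forall>w\<in>ball z (2 * (min e e' / 2)). cmod (f w) \<le> C" using e by auto
    qed
  qed
  have "locally_bounded_on (pd k f) \<Omega>"
    unfolding locally_bounded_on_def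
  proof
    fix z assume "z \<in> \<Omega>"
    then obtain r C where r: "r > 0" "ball z (2*r) \<subseteq> \<Omega>" and C: "\<And>w. w\<in>ball z (2*r) \<Longrightarrow> cmod (f w) \<le> C"
      using loc by blast
    have "cmod (pd k f w) \<le> 2 * C / r" if "w \<in> ball z r" for w
    proof -
      have sub: "w + axis k \<zeta> \<in> ball z (2*r)" if "\<zeta> \<in> ball 0 r" for \<zeta>
        using that \<open>w \<in> ball z r\<close> norm_triangle_ineq4[of "z - w" "axis k \<zeta>"]
        by (auto simp: dist_norm algebra_simps)
      have "cmod ((deriv ^^ 1) (\<lambda>\<zeta>. f (w + axis k \<zeta>)) 0) \<le> fact 1 * C / (r / 2) ^ 1"
      proof (rule Cauchy_deriv_bound)
        show "(\<lambda>\<zeta>. f (w + axis k \<zeta>)) holomorphic_on ball 0 r"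
          by (rule coord_holomorphic_line[OF fc]) (use sub r in auto)
      qed (use r sub C in auto)
      then show ?thesis by (simp add: pd_def mult.commute)
    qed
    then show "\<exists>e>0. \<exists>C. \<forall>w\<in>ball z e. cmod (pd k f w) \<le> C" using r(1) by metis
  qed
  moreover have "coord_holomorphic_on (pd k f) \<Omega>"
    unfolding coord_holomorphic_on_def
  proof (intro ballI allI)
    fix z j assume "z \<in> \<Omega>"
    then obtain r C where r: "r > 0" "ball z (2*r) \<subseteq> \<Omega>" and C: "\<And>w. w\<in>ball z (2*r) \<Longrightarrow> cmod (f w) \<le> C"
      using loc by blast
    have sub: "z + axis j \<eta> + axis k \<zeta> \<in> ball z (2*r)" if "\<zeta> \<in> ball 0 r" "\<eta> \<in> ball 0 r" for \<zeta> \<eta>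
      using that norm_triangle_ineq[of "axis k \<zeta>" "axis j \<eta>"]
        by (simp add: dist_norm norm_minus_commute flip: diff_diff_eq)
    have "(\<lambda>\<eta>. deriv (\<lambda>\<zeta>. f (z + axis j \<eta> + axis k \<zeta>)) 0) holomorphic_on ball 0 r"
    proof (rule holomorphic_deriv_parameter[OF open_ball r(1)])
      show "(\<lambda>\<zeta>. f (z + axis j \<eta> + axis k \<zeta>)) holomorphic_on ball 0 r" if "\<eta> \<in> ball 0 r" for \<eta>
        by (rule coord_holomorphic_line[OF fc]) (rule subsetD[OF r(2) sub[OF _ that]])
      have "(\<lambda>\<eta>. f (z + axis k \<zeta> + axis j \<eta>)) holomorphic_on ball 0 r" if "\<zeta> \<in> ball 0 r" for \<zeta>
        by (rule coord_holomorphic_line[OF fc]) (use subsetD[OF r(2) sub[OF that]] in \<open>simp add: add_ac\<close>)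
      then show "(\<lambda>\<eta>. f (z + axis j \<eta> + axis k \<zeta>)) holomorphic_on ball 0 r" if "\<zeta> \<in> ball 0 r" for \<zeta>
        using that by (simp add: add_ac)
    qed (rule C[OF sub])
    then show "(\<lambda>\<eta>. pd k f (z + axis j \<eta>)) field_differentiable at 0"
      using r(1) holomorphic_on_imp_differentiable_at[OF _ open_ball] by (simp add: pd_def)
  qed
  ultimately show ?thesis using osgood[OF \<Omega>] by blast
qed

section \<open>Identity theorem in several variables\<close>

lemma open_line_preimage:
  assumes "open \<Omega>"
  shows "open {\<zeta>::complex. a + \<zeta> *s v \<in> \<Omega>}"
proof -
  have "continuous_on UNIV (\<lambda>\<zeta>. a + \<zeta> *s v)"
    by (intro continuous_intros linear_continuous_on bounded_linear_smult_left)
  from open_vimage[OF assms this] show ?thesis by (simp add: vimage_def)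
qed

lemma convex_line_preimage:
  assumes "convex \<Omega>"
  shows "convex {\<zeta>::complex. a + \<zeta> *s v \<in> \<Omega>}"
proof (rule convexI, clarify)
  fix x y :: complex and s t :: real
  assume *: "a + x *s v \<in> \<Omega>" "a + y *s v \<in> \<Omega>" "0 \<le> s" "0 \<le> t" "s + t = 1"
  then have "s *\<^sub>R (a + x *s v) + t *\<^sub>R (a + y *s v) \<in> \<Omega>"
    using assms convexD by blast
  moreover have "s *\<^sub>R (a + x *s v) + t *\<^sub>R (a + y *s v) = (s + t) *\<^sub>R a + (s *\<^sub>R x + t *\<^sub>R y) *s v"
    by (simp add: vec_eq_iff scaleR_conv_of_real[where 'a=complex] algebra_simps)
  ultimately show "a + (s *\<^sub>R x + t *\<^sub>R y) *s v \<in> \<Omega>" using * by simp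
qed

text \<open>The complex line through \<open>b\<close> and \<open>c\<close> meets
  \<open>\<Omega>\<close> in a convex, hence connected, set of parameters, on which the one-variable
  identity theorem leads from 0 to 1.\<close>

lemma holomorphic_on_vec_eq_0_convex:
  fixes f :: "complex ^ 'm \<Rightarrow> complex"
  assumes \<Omega>: "open \<Omega>" "convex \<Omega>" and f: "holomorphic_on_vec f \<Omega>"
    and b: "b \<in> \<Omega>" and e: "e > 0" "\<And>w. w \<in> ball b e \<Longrightarrow> f w = 0" and c: "c \<in> \<Omega>"
  shows "f c = 0"
proof -
  define S where "S = {\<zeta>. b + \<zeta> *s (c - b) \<in> \<Omega>}"
  define U where "U = {\<zeta>. b + \<zeta> *s (c - b) \<in> ball b e}"
  have opS: "open S" "open U" unfolding S_def U_def by (intro open_line_preimage \<Omega> open_ball)+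
  have "0 \<in> S" "1 \<in> S" "0 \<in> U" using b c e by (auto simp: S_def U_def)
  have "(\<lambda>\<zeta>. f (b + \<zeta> *s (c - b))) 1 = 0"
  proof (rule analytic_continuation_open[where s = "S \<inter> U" and s' = S and g = "\<lambda>_. 0"
        and f = "\<lambda>\<zeta>. f (b + \<zeta> *s (c - b))" and z = 1])
    show "connected S" unfolding S_def by (intro convex_connected convex_line_preimage \<Omega>)
    show "(\<lambda>\<zeta>. f (b + \<zeta> *s (c - b))) holomorphic_on S"
      by (rule holomorphic_on_vec_line[OF f]) (simp add: S_def)
    show "S \<inter> U \<noteq> {}" using \<open>0 \<in> S\<close> \<open>0 \<in> U\<close> by blast
  qed (use opS \<open>1 \<in> S\<close> e in \<open>auto simp: U_def\<close>)
  then show ?thesis by simp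
qed

text \<open>The set \<open>Z\<close> of points near which \<open>f\<close> vanishes is open. So is
  its complement in \<open>\<Omega>\<close>: a ball in \<open>\<Omega>\<close> that meets
  \<open>Z\<close> has \<open>f = 0\<close> throughout, by the convex case.\<close>

theorem holomorphic_on_vec_eq_0:
  fixes f :: "complex ^ 'm \<Rightarrow> complex"
  assumes \<Omega>: "open \<Omega>" "connected \<Omega>" and f: "holomorphic_on_vec f \<Omega>"
    and b: "b \<in> \<Omega>" and e: "e > 0" "\<And>w. w \<in> ball b e \<Longrightarrow> f w = 0" and c: "c \<in> \<Omega>"
  shows "f c = 0"
proof -
  define Z where "Z = {z \<in> \<Omega>. \<exists>e>0. \<forall>w\<in>ball z e. f w = 0}"
  have "open Z"
    unfolding open_contains_ball
  proof
    fix z assume "z \<in> Z"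
    then obtain e where e: "e > 0" "\<forall>w\<in>ball z e. f w = 0" "z \<in> \<Omega>" by (auto simp: Z_def)
    obtain e' where e': "e' > 0" "ball z e' \<subseteq> \<Omega>" using \<Omega> e(3) open_contains_ball by blast
    have "ball z (min e e') \<subseteq> Z"
    proof
      fix w assume w: "w \<in> ball z (min e e')"
      then obtain d where "d > 0" "ball w d \<subseteq> ball z (min e e')"
        using open_ball open_contains_ball by metis
      then show "w \<in> Z" using e e' w by (auto simp: Z_def subset_iff intro!: exI[of _ d])
    qed
    then show "\<exists>e>0. ball z e \<subseteq> Z" using e e' by (metis min_less_iff_conj)
  qed
  have "open (\<Omega> - Z)"
    unfolding open_contains_ball
  proof
    fix a assume a: "a \<in> \<Omega> - Z"
    then obtain r where r: "r > 0" "ball a r \<subseteq> \<Omega>" using \<Omega> open_contains_ball by blast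
    have "ball a r \<inter> Z = {}"
    proof (rule ccontr)
      assume "ball a r \<inter> Z \<noteq> {}"
      then obtain z e where z: "z \<in> ball a r" "e > 0" "\<And>w. w\<in>ball z e \<Longrightarrow> f w = 0"
        unfolding Z_def by blast
      have "f w = 0" if "w \<in> ball a r" for w
        using holomorphic_on_vec_eq_0_convex[OF open_ball convex_ball holomorphic_on_vec_subset[OF f r(2)] z that] .
      then have "a \<in> Z" using a r by (auto simp: Z_def)
      then show False using a by blast
    qed
    then show "\<exists>e>0. ball a e \<subseteq> \<Omega> - Z" using r by blast
  qed
  have "b \<in> Z" using b e by (auto simp: Z_def)
  then have "\<Omega> \<subseteq> Z"
    using connectedD[OF \<Omega>(2) \<open>open Z\<close> \<open>open (\<Omega> - Z)\<close>] b by auto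
  then show ?thesis using c by (auto simp: Z_def)
qed

section \<open>A discrete sub-mean-value inequality\<close>

lemma cis_diff_le: "cmod (cis a - cis b) \<le> \<bar>a - b\<bar>"
proof -
  have "cis a - cis b = cis b * (exp (\<i> * of_real (a - b)) - 1)"
    by (simp add: algebra_simps cis_mult cis_conv_exp flip: exp_add)
  then have "cmod (cis a - cis b) = dist (exp (\<i> * of_real (a - b))) 1"
    by (simp add: norm_mult dist_norm)
  also have "\<dots> = 2 * \<bar>sin ((a - b) / 2)\<bar>" by (simp only: dist_norm dist_exp_i_1)
  also have "\<dots> \<le> \<bar>a - b\<bar>" using abs_sin_x_le_abs_x[of "(a-b)/2"] by simp
  finally show ?thesis .
qed

lemma cis_root_mod: "N > 0 \<Longrightarrow> cis (2 * pi * real (m mod N) / real N) = cis (2 * pi * real m / real N)"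
proof -
  assume N: "N > 0"
  have "real m = real N * real (m div N) + real (m mod N)"
    by (metis mult_div_mod_eq of_nat_add of_nat_mult)
  then have "2 * pi * real m / real N = 2 * pi * real (m div N) + 2 * pi * real (m mod N) / real N"
    using N by (simp add: field_simps)
  moreover have "cis (2 * pi * real (m div N)) = 1" by (rule cis_multiple_2pi) auto
  ultimately show ?thesis by (simp flip: cis_mult)
qed

text \<open>Rotation by a root of unity permutes the \<open>N\<close>-th roots of unity, so a
  product over them can be reindexed.\<close>

lemma bij_betw_add_mod: "bij_betw (\<lambda>j. (j + l) mod N) {..<N} {..<(N::nat)}"
proof -
  have *: "j = j'" if "(j + l) mod N = (j' + l) mod N" "j \<le> j'" "j' < N" for j j'
  proof -
    have "N dvd (j' + l) - (j + l)" using that by (metis mod_eq_dvd_iff_nat add_le_mono1)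
    then show ?thesis using that by (simp add: dvd_imp_le) (metis dvd_imp_le diff_is_0_eq le_antisym less_imp_diff_less linorder_not_less zero_less_iff_neq_zero)
  qed
  have "inj_on (\<lambda>j. (j + l) mod N) {..<N}"
    by (rule inj_onI) (metis * lessThan_iff linear)
  moreover have "(\<lambda>j. (j + l) mod N) ` {..<N} \<subseteq> {..<N}" by auto
  ultimately show ?thesis by (metis bij_betw_def endo_inj_surj finite_lessThan)
qed

text \<open>A sub-mean-value property of \<open>log |g|\<close>: the maximum principle is applied to the product of
  the rotations of \<open>g\<close> by the \<open>N\<close>-th roots of unity, where \<open>N\<close> is large by uniform continuity.\<close>

lemma cmod_le_interpolation:
  fixes g :: "complex ^ 'm \<Rightarrow> complex"
  assumes g: "holomorphic_on_vec g \<Omega>" and sub: "cball y \<rho> \<subseteq> \<Omega>" and \<rho>: "0 < \<rho>"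
    and \<alpha>: "0 < \<alpha>" "\<alpha> \<le> \<beta>" and \<beta>: "\<And>z. z \<in> cball y \<rho> \<Longrightarrow> cmod (g z) \<le> \<beta>"
    and sel: "\<And>N. N > 0 \<Longrightarrow> \<exists>v. norm v \<le> \<rho> \<and>
      real (card {j. j < N \<and> \<not> cmod (g (y + cis (2 * pi * real j / real N) *s v)) \<le> \<alpha>}) \<le> \<epsilon> * real N"
  shows "cmod (g y) \<le> 2 * \<alpha> * (\<beta> / \<alpha>) powr \<epsilon>"
proof -
  have cont: "continuous_on (cball y \<rho>) g"
    using continuous_on_subset[OF holomorphic_on_vec_imp_continuous[OF g] sub] .
  have "uniformly_continuous_on (cball y \<rho>) g"
    by (rule compact_uniformly_continuous[OF cont compact_cball])
  then obtain d where d: "d > 0"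
    and uc: "\<And>z z'. z \<in> cball y \<rho> \<Longrightarrow> z' \<in> cball y \<rho> \<Longrightarrow> dist z' z < d \<Longrightarrow> dist (g z') (g z) < \<alpha>"
    using \<alpha>(1) unfolding uniformly_continuous_on_def by meson
  \<comment> \<open>Neighbouring sample points on a circle of radius at most \<open>\<rho>\<close>
    are then less than \<open>d\<close> apart.\<close>
  obtain N :: nat where N: "2 * pi * \<rho> / d < real N" using reals_Archimedean2 by blast
  have "0 < 2 * pi * \<rho> / d" using \<rho> d by simp
  then have N0: "N > 0" using N by (cases N) auto
  have Nd: "2 * pi / real N * \<rho> < d" using N N0 d by (simp add: field_simps)
  define w where "w j = cis (2 * pi * real j / real N)" for j :: nat
  obtain v where v: "norm v \<le> \<rho>" and card: "real (card {j. j < N \<and> \<not> cmod (g (y + w j *s v)) \<le> \<alpha>}) \<le> \<epsilon> * real N"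
    using sel[OF N0] unfolding w_def by blast
  define B where "B = {j. j < N \<and> \<not> cmod (g (y + w j *s v)) \<le> \<alpha>}"
  have B: "B \<subseteq> {..<N}" by (auto simp: B_def)
  then have finB: "finite B" using finite_subset by blast
  \<comment> \<open>The doubled bounds absorb the error \<open>\<alpha>\<close> of uniform
    continuity; at bad points this uses \<open>\<alpha> \<le> \<beta>\<close>.\<close>
  define c where "c j = (if j \<in> B then 2 * \<beta> else 2 * \<alpha>)" for j
  have c0: "c j > 0" for j using \<alpha> by (simp add: c_def)
  have in_ball: "y + \<zeta> *s v \<in> cball y \<rho>" if "cmod \<zeta> \<le> 1" for \<zeta>
    using that v mult_mono[of "cmod \<zeta>" 1 "norm v" \<rho>] by (simp add: dist_norm norm_smult)
  have wc: "cmod (g (y + w j *s v)) + \<alpha> \<le> c j" if "j < N" for j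
    using \<beta>[OF in_ball[of "w j"]] \<alpha> that by (auto simp: c_def B_def w_def)
  \<comment> \<open>All factors agree at 0, so \<open>G 0 = g y ^ N\<close>, and an
    \<open>N\<close>-th root at the end removes \<open>N\<close> from the bound.\<close>
  define G where "G \<zeta> = (\<Prod>j<N. g (y + (w j * \<zeta>) *s v))" for \<zeta>
  have G_eq: "G = (\<lambda>\<zeta>. \<Prod>j<N. g (y + (w j * \<zeta>) *s v))" by (simp add: G_def fun_eq_iff)
  have lineg: "(\<lambda>\<zeta>. g (y + \<zeta> *s v)) holomorphic_on ball 0 1"
    by (rule holomorphic_on_vec_line[OF g]) (use in_ball sub in \<open>auto simp: subset_iff\<close>)
  have linec: "continuous_on (cball 0 1) (\<lambda>\<zeta>. g (y + \<zeta> *s v))"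
  proof (rule continuous_on_compose2[OF cont, where f = "\<lambda>\<zeta>. y + \<zeta> *s v"])
    show "continuous_on (cball 0 1) (\<lambda>\<zeta>. y + \<zeta> *s v)"
      by (rule continuous_on_add[OF continuous_on_const linear_continuous_on[OF bounded_linear_smult_left]])
    show "(\<lambda>\<zeta>. y + \<zeta> *s v) ` cball 0 1 \<subseteq> cball y \<rho>" using in_ball by auto
  qed
  have "cmod (G 0) \<le> (\<Prod>j<N. c j)"
  proof (rule maximum_modulus_frontier[where S = "cball 0 1" and f = G and \<xi> = 0])
    show "G holomorphic_on interior (cball 0 1)"
      unfolding G_eq
    proof (intro holomorphic_on_prod)
      fix j
      have "((\<lambda>\<zeta>. g (y + \<zeta> *s v)) \<circ> (\<lambda>\<zeta>. w j * \<zeta>)) holomorphic_on ball 0 1"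
        by (rule holomorphic_on_compose_gen[OF _ lineg])
           (auto intro!: holomorphic_intros simp: norm_mult w_def)
      then show "(\<lambda>\<zeta>. g (y + (w j * \<zeta>) *s v)) holomorphic_on interior (cball 0 1)"
        by (simp add: o_def interior_cball)
    qed
    show "continuous_on (closure (cball 0 1)) G"
      unfolding G_eq
      by (intro continuous_on_prod continuous_on_compose2[OF linec])
         (auto intro!: continuous_intros simp: norm_mult w_def)
    fix \<zeta> :: complex assume "\<zeta> \<in> frontier (cball 0 1)"
    then have \<zeta>1: "cmod \<zeta> = 1" by (simp add: frontier_cball)
    define \<theta> where "\<theta> = Arg2pi \<zeta>"
    have \<theta>: "0 \<le> \<theta>" "\<theta> < 2 * pi" "\<zeta> = cis \<theta>"
      using Arg2pi[of \<zeta>] \<zeta>1 by (auto simp: \<theta>_def cis_conv_exp is_Arg_def)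
    \<comment> \<open>The angle of \<open>\<zeta>\<close> is rounded down to a multiple of
      \<open>2 * pi / N\<close>. The same shift \<open>l\<close> serves every factor, which is what
      permutes the bounds \<open>c j\<close>.\<close>
    define l where "l = nat \<lfloor>\<theta> * real N / (2 * pi)\<rfloor>"
    have "0 \<le> \<theta> * real N / (2 * pi)" using \<theta> by simp
    then have l: "real l \<le> \<theta> * real N / (2 * pi)" "\<theta> * real N / (2 * pi) < real l + 1"
      unfolding l_def by linarith+
    define \<tau> where "\<tau> = \<theta> - 2 * pi * real l / real N"
    have \<tau>: "0 \<le> \<tau>" "\<tau> \<le> 2 * pi / real N"
    proof -
      have *: "2 * pi * real l \<le> \<theta> * real N" "\<theta> * real N \<le> 2 * pi * real l + 2 * pi"
        using l by (simp_all add: field_simps)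
      show "0 \<le> \<tau>" using *(1) N0 by (simp add: \<tau>_def pos_divide_le_eq)
      have "\<theta> \<le> (2 * pi * real l + 2 * pi) / real N" using *(2) N0 by (simp add: pos_le_divide_eq)
      then show "\<tau> \<le> 2 * pi / real N" by (simp add: \<tau>_def add_divide_distrib)
    qed
    have le: "cmod (g (y + (w j * \<zeta>) *s v)) \<le> c ((j + l) mod N)" if "j < N" for j
    proof -
      define j' where "j' = (j + l) mod N"
      have j': "j' < N" using N0 by (simp add: j'_def)
      have "w j' = cis (2 * pi * real (j + l) / real N)"
        unfolding w_def j'_def by (rule cis_root_mod[OF N0])
      moreover have "w j * \<zeta> = cis (2 * pi * real j / real N + \<theta>)"
        by (simp add: w_def \<theta>(3) cis_mult)
      ultimately have "cmod (w j * \<zeta> - w j') \<le> \<bar>(2 * pi * real j / real N + \<theta>) - 2 * pi * real (j + l) / real N\<bar>"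
        by (simp only: cis_diff_le)
      also have "\<dots> = \<tau>" using \<tau> by (simp add: \<tau>_def add_divide_distrib distrib_left)
      finally have "cmod (w j * \<zeta> - w j') * norm v \<le> 2 * pi / real N * \<rho>"
        using \<tau> v by (intro mult_mono) auto
      moreover have "dist (y + (w j * \<zeta>) *s v) (y + w j' *s v) = cmod (w j * \<zeta> - w j') * norm v"
        by (simp add: dist_norm norm_smult flip: vector_sub_rdistrib)
      ultimately have "dist (g (y + (w j * \<zeta>) *s v)) (g (y + w j' *s v)) < \<alpha>"
        using Nd by (intro uc in_ball) (auto simp: norm_mult \<zeta>1 w_def)
      then have "cmod (g (y + (w j * \<zeta>) *s v)) \<le> cmod (g (y + w j' *s v)) + \<alpha>"
        using norm_triangle_ineq2[of "g (y + (w j * \<zeta>) *s v)" "g (y + w j' *s v)"] by (simp add: dist_norm)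
      then show ?thesis using wc[OF j'] by (simp add: j'_def)
    qed
    have "cmod (G \<zeta>) = (\<Prod>j<N. cmod (g (y + (w j * \<zeta>) *s v)))" by (simp add: G_def prod_norm)
    also have "\<dots> \<le> (\<Prod>j<N. c ((j + l) mod N))" by (intro prod_mono) (auto simp: le)
    also have "\<dots> = (\<Prod>j<N. c j)" by (rule prod.reindex_bij_betw[OF bij_betw_add_mod])
    finally show "cmod (G \<zeta>) \<le> (\<Prod>j<N. c j)" .
  qed auto
  also have "(\<Prod>j<N. c j) = (\<Prod>j<N. (2 * \<alpha>) * (if j \<in> B then \<beta> / \<alpha> else 1))"
    using \<alpha> by (intro prod.cong) (auto simp: c_def)
  also have "\<dots> = (2 * \<alpha>) ^ N * (\<beta> / \<alpha>) ^ card B"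
    using B by (simp add: prod.distrib prod.If_cases Int_absorb1 Collect_mem_eq)
  also have "(\<beta> / \<alpha>) ^ card B = (\<beta> / \<alpha>) powr (real (card B))"
    using \<alpha> by (simp add: powr_realpow)
  also have "\<dots> \<le> (\<beta> / \<alpha>) powr (\<epsilon> * real N)"
    using card \<alpha> by (intro powr_mono) (auto simp: B_def)
  also have "\<dots> = ((\<beta> / \<alpha>) powr \<epsilon>) ^ N"
    using \<alpha> by (simp add: powr_realpow[symmetric] powr_powr)
  finally have "cmod (g y) ^ N \<le> (2 * \<alpha> * (\<beta> / \<alpha>) powr \<epsilon>) ^ N"
    using \<alpha> by (simp add: G_def norm_power power_mult_distrib)
  then show ?thesis
    using N0 \<alpha> by (subst (asm) power_mono_iff) auto
qed

section \<open>Measure and rotations in complex vector spaces\<close>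

text \<open>The index type is \<open>'m bit0\<close> rather than \<open>'m + 'm\<close> because the library proves that Lebesgue measure
  is invariant under orthogonal maps only for well-ordered index types.\<close>

lemma complex_vec_isometry:
  obtains J :: "real ^ 'm bit0 \<Rightarrow> complex ^ 'm" and J'
  where "linear J" "linear J'" "\<And>y. J (J' y) = y" "\<And>x. J' (J x) = x" "\<And>x. norm (J x) = norm x"
proof -
  have "card (UNIV :: 'm bit0 set) = card (UNIV :: ('m + 'm) set)"
    by (simp add: card_UNIV_sum)
  then obtain \<sigma> :: "'m bit0 \<Rightarrow> 'm + 'm" where \<sigma>: "bij \<sigma>"
    using finite_same_card_bij[of "UNIV :: 'm bit0 set" "UNIV :: ('m + 'm) set"] by auto
  define \<tau> where "\<tau> = inv \<sigma>"
  have st: "\<sigma> (\<tau> t) = t" "\<tau> (\<sigma> s) = s" for s t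
    using \<sigma> by (simp_all add: \<tau>_def bij_is_surj surj_f_inv_f bij_is_inj)
  have \<tau>: "bij \<tau>" using \<sigma> by (simp add: \<tau>_def bij_imp_bij_inv)
  define J :: "real ^ 'm bit0 \<Rightarrow> complex ^ 'm"
    where "J x = (\<chi> i. Complex (x $ \<tau> (Inl i)) (x $ \<tau> (Inr i)))" for x
  define J' :: "complex ^ 'm \<Rightarrow> real ^ 'm bit0"
    where "J' y = (\<chi> s. case \<sigma> s of Inl i \<Rightarrow> Re (y $ i) | Inr i \<Rightarrow> Im (y $ i))" for y
  show ?thesis
  proof
    show "linear J"
      by (rule linearI) (simp_all add: J_def vec_eq_iff complex_eq_iff)
    show "linear J'"
      by (rule linearI) (auto simp: J'_def vec_eq_iff split: sum.split)
    show "J (J' y) = y" for y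
      by (simp add: J_def J'_def vec_eq_iff st complex_eq_iff)
    show "J' (J x) = x" for x
    proof -
      have "(case \<sigma> s of Inl i \<Rightarrow> x $ \<tau> (Inl i) | Inr i \<Rightarrow> x $ \<tau> (Inr i)) = x $ s" for s
        using st(2)[of s] by (cases "\<sigma> s") auto
      then show ?thesis by (simp add: J_def J'_def vec_eq_iff cong: sum.case_cong)
    qed
    show "norm (J x) = norm x" for x
    proof -
      have "(\<Sum>i\<in>UNIV. (cmod (J x $ i))\<^sup>2) = (\<Sum>i\<in>UNIV. (x $ \<tau> (Inl i))\<^sup>2) + (\<Sum>i\<in>UNIV. (x $ \<tau> (Inr i))\<^sup>2)"
        by (simp add: J_def cmod_def sum.distrib)
      also have "\<dots> = (\<Sum>t\<in>UNIV. (x $ \<tau> t)\<^sup>2)"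
        by (subst UNIV_sum, subst sum.union_disjoint) (auto simp: sum.reindex)
      also have "\<dots> = (\<Sum>s\<in>UNIV. (x $ s)\<^sup>2)"
        by (rule sum.reindex_bij_betw[OF \<tau>])
      finally show ?thesis by (simp add: norm_vec_def L2_set_def)
    qed
  qed
qed

text \<open>For \<open>v\<close> uniformly distributed in a ball of radius \<open>R/2\<close>, each
  rotated point misses \<open>E m\<close> with probability below \<open>\<epsilon>\<close>, so the
  expected number of misses is below \<open>\<epsilon> * N\<close> and some \<open>v\<close> does at
  least as well. Translations and rotations preserve measure, hence one \<open>m\<close> serves all
  \<open>y\<close> and \<open>N\<close>.\<close>

lemma exists_few_bad_rotations:
  fixes E :: "nat \<Rightarrow> (complex ^ 'm) set"
  assumes closed: "\<And>k. closed (E k)" and mono: "\<And>k. E k \<subseteq> E (Suc k)"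
    and cover: "cball p R \<subseteq> (\<Union>k. E k)" and R: "0 < R" and \<epsilon>: "0 < \<epsilon>"
  obtains m where "\<And>y N. y \<in> cball p (R/4) \<Longrightarrow> 0 < N \<Longrightarrow>
    \<exists>v. norm v \<le> R/2 \<and> real (card {j. j < N \<and> y + cis (2 * pi * real j / real N) *s v \<notin> E m}) \<le> \<epsilon> * real N"
proof -
  obtain J :: "real ^ 'm bit0 \<Rightarrow> complex ^ 'm" and J' :: "complex ^ 'm \<Rightarrow> real ^ 'm bit0" where lin: "linear J" "linear J'"
    and JJ': "\<And>y. J (J' y) = y" and J'J: "\<And>x. J' (J x) = x" and nJ: "\<And>x. norm (J x) = norm x"
    by (rule complex_vec_isometry[where 'm = 'm]; rule that; assumption)
  have nJ': "norm (J' y) = norm y" for y using nJ[of "J' y"] by (simp add: JJ')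
  define \<mu> where "\<mu> = measure (lebesgue :: (real ^ 'm bit0) measure)"
  have cJ: "continuous_on UNIV J" by (rule linear_continuous_on) (use lin in \<open>simp add: linear_conv_bounded_linear\<close>)
  \<comment> \<open>The part of the ball not yet covered, transported to real coordinates. These
    sets decrease to the empty set and have finite measure, so their measures tend to 0.\<close>
  define S where "S k = cball (J' p) R - J -` E k" for k
  have S: "S k \<in> lmeasurable" for k
  proof -
    have "closed (J -` E k)" using closed_vimage[OF closed cJ] by simp
    then have "S k \<in> sets lebesgue" unfolding S_def by (intro sets.Diff) auto
    moreover have "bounded (S k)" unfolding S_def by (rule bounded_subset[OF bounded_cball]) auto
    ultimately show ?thesis by (simp add: bounded_set_imp_lmeasurable)
  qed
  have "(\<lambda>k. \<mu> (S k)) \<longlonglongrightarrow> \<mu> (\<Inter>k. S k)"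
    unfolding \<mu>_def
  proof (rule Lim_measure_decseq)
    show "range S \<subseteq> sets lebesgue" using S by (auto simp: fmeasurableD)
    show "decseq S" unfolding decseq_Suc_iff S_def using mono by blast
    show "emeasure lebesgue (S i) \<noteq> \<infinity>" for i using fmeasurableD2[OF S] by simp
  qed
  moreover have "(\<Inter>k. S k) = {}"
  proof -
    have "x \<notin> (\<Inter>k. S k)" for x
    proof
      assume x: "x \<in> (\<Inter>k. S k)"
      have "J x - p = J (x - J' p)" using lin by (simp add: linear_diff JJ')
      then have "norm (J x - p) = norm (x - J' p)" by (simp add: nJ)
      moreover have "x \<in> cball (J' p) R" using x by (simp add: S_def)
      ultimately have "J x \<in> cball p R" by (simp add: dist_norm norm_minus_commute)
      then show False using cover x by (auto simp: S_def)
    qed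
    then show ?thesis by blast
  qed
  ultimately have lim: "(\<lambda>k. \<mu> (S k)) \<longlonglongrightarrow> 0" by (simp add: \<mu>_def)
  define B where "B = cball (0 :: real ^ 'm bit0) (R/2)"
  have \<mu>B: "\<mu> B > 0" using content_cball_pos[of "R/2"] R by (simp add: \<mu>_def B_def)
  then have "\<epsilon> * \<mu> B > 0" using \<epsilon> by simp
  then have "\<forall>\<^sub>F k in sequentially. \<mu> (S k) < \<epsilon> * \<mu> B" using lim by (simp add: order_tendsto_iff)
  then obtain m where m: "\<mu> (S m) < \<epsilon> * \<mu> B" using eventually_sequentially by auto
  show ?thesis
  proof (rule that)
    fix y N assume y: "y \<in> cball p (R/4)" and N: "0 < (N::nat)"
    define w where "w j = cis (2 * pi * real j / real N)" for j :: nat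
    define T where "T j x = J' (w j *s J x)" for j x
    have linT: "linear (T j)" for j
    proof (rule linearI)
      have "w j *s (c *\<^sub>R u) = c *\<^sub>R (w j *s u)" for c and u :: "complex ^ 'm"
        by (simp add: vec_eq_iff)
      then show "T j (c *\<^sub>R x) = c *\<^sub>R T j x" for c x
        by (simp add: T_def linear_scale[OF lin(1)] linear_scale[OF lin(2)])
      show "T j (x + x') = T j x + T j x'" for x x'
        by (simp add: T_def linear_add[OF lin(1)] linear_add[OF lin(2)] vector_add_ldistrib)
    qed
    have nT: "norm (T j x) = norm x" for j x by (simp add: T_def nJ' norm_smult nJ w_def)
    have oT: "orthogonal_transformation (T j)" for j
      by (simp add: orthogonal_transformation linT nT)
    define U where "U j = {x \<in> B. y + w j *s J x \<notin> E m}" for j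
    have U: "U j \<in> lmeasurable" for j
    proof -
      have "closed ((\<lambda>x. y + J (T j x)) -` E m)"
      proof (rule closed_vimage[OF closed])
        have "continuous_on UNIV (T j)" 
          by (rule linear_continuous_on) (use linT in \<open>simp add: linear_conv_bounded_linear\<close>)
        from continuous_on_compose2[OF cJ this]
        show "continuous_on UNIV (\<lambda>x. y + J (T j x))" by (intro continuous_intros) auto
      qed
      moreover have "U j = B - (\<lambda>x. y + J (T j x)) -` E m" by (auto simp: U_def T_def JJ')
      ultimately have "U j \<in> sets lebesgue" by (auto simp: B_def)
      moreover have "bounded (U j)" unfolding U_def B_def by (rule bounded_subset[OF bounded_cball[of 0 "R/2"]]) auto
      ultimately show ?thesis by (simp add: bounded_set_imp_lmeasurable)
    qed
    \<comment> \<open>The isometry \<open>x \<mapsto> J' y + T j x\<close> carries the bad vectors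
      into \<open>S m\<close>; the image stays in the ball since
      \<open>R/4 + R/2 \<le> R\<close>.\<close>
    have \<mu>U: "\<mu> (U j) \<le> \<mu> (S m)" for j
    proof -
      have "\<mu> (U j) = \<mu> ((+) (J' y) ` T j ` U j)"
        using measure_orthogonal_image[OF oT U] by (simp add: \<mu>_def measure_translation)
      also have "\<dots> \<le> \<mu> (S m)"
        unfolding \<mu>_def
      proof (rule measure_mono_fmeasurable[OF _ _ S])
        show "(+) (J' y) ` T j ` U j \<in> sets lebesgue"
          by (intro fmeasurableD measurable_translation measurable_orthogonal_image[OF oT U])
        show "(+) (J' y) ` T j ` U j \<subseteq> S m"
        proof clarify
          fix x assume x: "x \<in> U j"
          have eq: "J (J' y + T j x) = y + w j *s J x" using lin by (simp add: linear_add T_def JJ')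
          have "norm (J' y + T j x - J' p) = norm (J' (y - p) + T j x)"
            using lin by (simp add: linear_diff algebra_simps)
          also have "\<dots> \<le> norm (y - p) + norm x"
            using norm_triangle_ineq[of "J' (y - p)" "T j x"] by (simp add: nJ' nT)
          also have "\<dots> \<le> R"
            using y x R by (simp add: U_def B_def dist_norm norm_minus_commute)
          finally show "J' y + T j x \<in> S m"
            using x eq by (simp add: S_def U_def dist_norm norm_minus_commute)
        qed
      qed
      finally show ?thesis .
    qed
    show "\<exists>v. norm v \<le> R/2 \<and> real (card {j. j < N \<and> y + cis (2 * pi * real j / real N) *s v \<notin> E m}) \<le> \<epsilon> * real N"
    proof (rule ccontr)
      assume "\<not> ?thesis"
      then have many: "\<epsilon> * real N < real (card {j. j < N \<and> y + w j *s v \<notin> E m})" if "norm v \<le> R/2" for v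
        using that unfolding w_def by (meson not_le)
      have int: "integrable lebesgue (\<lambda>x. indicator (U j) x :: real)" for j
        using U[of j] by (intro integrable_real_indicator) (auto simp: fmeasurable_def simp del: emeasure_completion)
      have intB: "integrable lebesgue (\<lambda>x. indicator B x :: real)"
        using lmeasurable_cball[of 0 "R/2"] unfolding B_def
        by (intro integrable_real_indicator) (auto simp: fmeasurable_def simp del: emeasure_completion)
      \<comment> \<open>The number of bad rotations is integrated over \<open>B\<close>, pointwise
        in \<open>x\<close> on one side and rotation by rotation on the other.\<close>
      have "\<epsilon> * real N * \<mu> B = (\<integral>x. \<epsilon> * real N * indicator B x \<partial>lebesgue)"
        by (simp add: \<mu>_def)
      also have "\<dots> \<le> (\<integral>x. (\<Sum>j<N. indicator (U j) x) \<partial>lebesgue)"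
      proof (rule integral_mono)
        show "integrable lebesgue (\<lambda>x. \<epsilon> * real N * indicator B x)" using intB by simp
        show "integrable lebesgue (\<lambda>x. \<Sum>j<N. indicator (U j) x :: real)" using int by simp
        fix x
        show "\<epsilon> * real N * indicator B x \<le> (\<Sum>j<N. indicator (U j) x :: real)"
        proof (cases "x \<in> B")
          case True
          then have "{j. j < N \<and> y + w j *s J x \<notin> E m} = {j \<in> {..<N}. x \<in> U j}" by (auto simp: U_def)
          moreover have "(\<Sum>j<N. indicator (U j) x :: real) = real (card {j \<in> {..<N}. x \<in> U j})"
            by (simp add: indicator_def sum.If_cases Collect_conj_eq lessThan_def)
          ultimately show ?thesis
            using many[of "J x"] True by (simp add: nJ B_def)
        qed (auto intro: sum_nonneg)
      qed
      also have "\<dots> = (\<Sum>j<N. \<mu> (U j))" using int by (simp add: \<mu>_def)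
      also have "\<dots> \<le> (\<Sum>j<N. \<mu> (S m))" by (intro sum_mono \<mu>U)
      finally show False using m N by simp
    qed
  qed
qed

section \<open>Hartogs' theorem\<close>

text \<open>The block \<open>x\<close> is sliced by complex lines \<open>b + \<zeta> *s u\<close>,
  so only one-variable Taylor series occur; \<open>y\<close> stays a vector and is handled by the
  interpolation on circles.\<close>

theorem hartogs_locally_bounded:
  fixes f :: "complex ^ 'n \<Rightarrow> complex ^ 'm \<Rightarrow> complex"
  assumes X: "open X" and Y: "open Y"
    and hx: "\<And>y. y \<in> Y \<Longrightarrow> holomorphic_on_vec (\<lambda>x. f x y) X"
    and hy: "\<And>x. x \<in> X \<Longrightarrow> holomorphic_on_vec (f x) Y"
    and p: "p \<in> X" and q: "q \<in> Y"
  shows "\<exists>e>0. \<exists>C. \<forall>x\<in>ball p e. \<forall>y\<in>ball q e. cmod (f x y) \<le> C"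
proof -
  obtain R1 where R1: "R1 > 0" "cball p R1 \<subseteq> X" using X p open_contains_cball by blast
  obtain R2 where R2: "R2 > 0" "cball q R2 \<subseteq> Y" using Y q open_contains_cball by blast
  \<comment> \<open>The halving makes room for \<open>cball p (2 * R)\<close>: the centre
    \<open>b\<close> found below is within \<open>R/8\<close> of \<open>p\<close>, and
    \<open>cball b R\<close> has to lie in \<open>X\<close>.\<close>
  define R where "R = min R1 R2 / 2"
  have R: "R > 0" using R1 R2 by (simp add: R_def)
  have pX: "cball p (2 * R) \<subseteq> X" and qY: "cball q R \<subseteq> Y"
    using R1 R2 by (auto simp: R_def)
  have fx_cont: "continuous_on X (\<lambda>x. f x y)" if "y \<in> Y" for y
    by (rule holomorphic_on_vec_imp_continuous[OF hx[OF that]])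
  have fy_cont: "continuous_on Y (f x)" if "x \<in> X" for x
    by (rule holomorphic_on_vec_imp_continuous[OF hy[OF that]])
  define F where "F k = {x \<in> cball p (R/8). \<forall>y\<in>cball q R. cmod (f x y) \<le> real k}" for k :: nat
  have subX: "cball p (R/8) \<subseteq> X" using pX R by auto
  have F_closed: "closed (F k)" for k
  proof -
    have "F k = cball p (R/8) \<inter> (\<Inter>y\<in>cball q R. {x \<in> cball p (R/8). cmod (f x y) \<le> real k})"
      by (auto simp: F_def)
    moreover have "closed {x \<in> cball p (R/8). cmod (f x y) \<le> real k}" if "y \<in> cball q R" for y
      using that qY by (intro continuous_on_closed_Collect_le continuous_intros continuous_on_subset[OF fx_cont subX]) auto
    ultimately show ?thesis by (simp add: closed_INT closed_Int)
  qed
  have F_cover: "cball p (R/8) \<subseteq> (\<Union>k. F k)"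
  proof
    fix x assume x: "x \<in> cball p (R/8)"
    have "compact (f x ` cball q R)"
      by (intro compact_continuous_image continuous_on_subset[OF fy_cont qY] compact_cball) (use x subX in blast)
    then have "bounded (f x ` cball q R)" by (rule compact_imp_bounded)
    then obtain B where B: "\<forall>y\<in>cball q R. cmod (f x y) \<le> B" unfolding bounded_iff by auto
    obtain k where "B \<le> real k" using real_arch_simple by blast
    then have "x \<in> F k" using x B unfolding F_def by (auto intro: order_trans)
    then show "x \<in> (\<Union>k. F k)" by blast
  qed
  txt \<open>By Baire's theorem \<open>f\<close> is bounded on \<open>ball b r0 \<times> cball q R\<close> for some \<open>b\<close> near \<open>p\<close>, with no
    control on \<open>r0\<close>.\<close>
  obtain k b r0 where r0: "r0 > 0" "ball b r0 \<subseteq> F k"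
  proof (rule ccontr)
    assume no: "\<not> thesis"
    have dense: "UNIV \<subseteq> closure (- F k)" for k
    proof -
      have "interior (F k) = {}"
        using no that by (meson equals0I mem_interior)
      then show ?thesis by (simp add: closure_complement)
    qed
    have "UNIV \<subseteq> closure (\<Inter> (range (\<lambda>k. - F k)))"
      by (rule Baire) (use dense F_closed in auto)
    then have "p \<in> closure (\<Inter> (range (\<lambda>k. - F k)))" by blast
    moreover have "\<Inter> (range (\<lambda>k. - F k)) \<subseteq> - ball p (R/8)"
    proof
      fix x assume x: "x \<in> \<Inter> (range (\<lambda>k. - F k))"
      then have "x \<notin> cball p (R/8)" using F_cover by blast
      then show "x \<in> - ball p (R/8)" by simp
    qed
    then have "closure (\<Inter> (range (\<lambda>k. - F k))) \<subseteq> - ball p (R/8)"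
      by (intro closure_minimal) auto
    ultimately show False using R by auto
  qed
  \<comment> \<open>The cap gives \<open>R/r \<ge> 2\<close>, so that \<open>ln (R/r)\<close> is
    positive.\<close>
  define r where "r = min r0 (R/2)"
  have r: "r > 0" "r \<le> R/2" using r0 R by (auto simp: r_def)
  have b: "b \<in> cball p (R/8)" using r0(2) centre_in_ball[of b r0] r0(1) unfolding F_def by blast
  have bX: "cball b R \<subseteq> X"
  proof
    fix x assume "x \<in> cball b R"
    then have "dist p x \<le> 2 * R" using b R dist_triangle[of p x b] by simp
    then show "x \<in> X" using pX by auto
  qed
  have C: "cmod (f x y) \<le> real k" if "x \<in> ball b r" "y \<in> cball q R" for x y
  proof -
    have "x \<in> F k" using that(1) r0(2) by (auto simp: r_def)
    then show ?thesis using that(2) by (auto simp: F_def)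
  qed
  \<comment> \<open>Any number strictly between 1 and 2 could replace \<open>4/3\<close>: the final
    series has ratio \<open>(2/R) * (4/3) * (R/4) = 2/3\<close>.\<close>
  define \<epsilon> where "\<epsilon> = ln (4/3) / ln (R/r)"
  have Rr: "R / r \<ge> 2" using r by (simp add: pos_le_divide_eq)
  then have Rr0: "R / r > 1" by linarith
  define t where "t = ln (R/r)"
  have t: "t > 0" using ln_gt_zero[OF Rr0] by (simp only: t_def)
  have \<epsilon>: "\<epsilon> > 0" "(R/r) powr \<epsilon> = 4/3"
  proof -
    have \<epsilon>_t: "\<epsilon> = ln (4/3) / t" by (simp only: \<epsilon>_def t_def)
    then show "\<epsilon> > 0" using t by simp
    have "(R/r) powr \<epsilon> = exp (\<epsilon> * t)" using Rr0 by (simp only: powr_def t_def) auto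
    also have "\<dots> = 4/3" using t by (simp add: \<epsilon>_t)
    finally show "(R/r) powr \<epsilon> = 4/3" .
  qed
  \<comment> \<open>For each fixed \<open>y\<close> the function is bounded on the compact
    \<open>cball b R\<close>, so these sets exhaust \<open>cball q R\<close>. The radius is now the
    large one, at the price of a bound depending on \<open>y\<close>.\<close>
  define E where "E m = {y \<in> cball q R. \<forall>x\<in>cball b R. cmod (f x y) \<le> real m}" for m :: nat
  have E_closed: "closed (E m)" for m
  proof -
    have "E m = cball q R \<inter> (\<Inter>x\<in>cball b R. {y \<in> cball q R. cmod (f x y) \<le> real m})"
      by (auto simp: E_def)
    moreover have "closed {y \<in> cball q R. cmod (f x y) \<le> real m}" if "x \<in> cball b R" for x
      using that bX by (intro continuous_on_closed_Collect_le continuous_intros continuous_on_subset[OF fy_cont qY]) auto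
    ultimately show ?thesis by (simp add: closed_INT closed_Int)
  qed
  have E_cover: "cball q R \<subseteq> (\<Union>k. E k)"
  proof
    fix y assume y: "y \<in> cball q R"
    have "compact ((\<lambda>x. f x y) ` cball b R)"
      by (intro compact_continuous_image continuous_on_subset[OF fx_cont bX] compact_cball) (use y qY in blast)
    then have "bounded ((\<lambda>x. f x y) ` cball b R)" by (rule compact_imp_bounded)
    then obtain B where B: "\<forall>x\<in>cball b R. cmod (f x y) \<le> B" unfolding bounded_iff by auto
    obtain k where "B \<le> real k" using real_arch_simple by blast
    then have "y \<in> E k" using y B unfolding E_def by (auto intro: order_trans)
    then show "y \<in> (\<Union>k. E k)" by blast
  qed
  have "E m \<subseteq> E (Suc m)" for m by (force simp: E_def)
  from exists_few_bad_rotations[OF E_closed this E_cover R \<epsilon>(1)]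
  obtain m where m: "\<And>y N. y \<in> cball q (R/4) \<Longrightarrow> 0 < N \<Longrightarrow>
    \<exists>v. norm v \<le> R/2 \<and> real (card {j. j < N \<and> y + cis (2 * pi * real j / real N) *s v \<notin> E m}) \<le> \<epsilon> * real N"
    by blast
  define M where "M = max 1 (max (real k) (real m))"
  txt \<open>The Taylor coefficients of \<open>f\<close> at \<open>b\<close> grow at most like \<open>(2/r)^i\<close> everywhere and like \<open>(2/R)^i\<close> on
    \<open>E m\<close>. Interpolating over rotations that mostly hit \<open>E m\<close> gives a rate close to \<open>2/R\<close> everywhere;
    the value of \<open>\<epsilon>\<close> makes it \<open>(2/R) * (4/3)\<close>, good enough to sum the series at distance \<open>R/4\<close> from \<open>b\<close>.\<close>
  define A where "A i u y = (deriv ^^ i) (\<lambda>\<zeta>. f (b + \<zeta> *s u) y) 0 / fact i" for i u y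
  have line_in: "b + \<zeta> *s u \<in> ball b s" if "norm u \<le> 1" "\<zeta> \<in> ball 0 s" for u \<zeta> s
    using that mult_left_mono[of "norm u" 1 "cmod \<zeta>"] by (simp add: dist_norm norm_smult)
  have line_hol: "(\<lambda>\<zeta>. f (b + \<zeta> *s u) y) holomorphic_on ball 0 s"
    if "norm u \<le> 1" "y \<in> cball q R" "s \<le> R" for u y s
    by (rule holomorphic_on_vec_line[OF hx]) (use that qY bX line_in[OF that(1)] in force)+
  have A1: "cmod (A i u y) \<le> M * (2 / r) ^ i" if "norm u \<le> 1" "y \<in> cball q R" for i u y
  proof -
    have "cmod ((deriv ^^ i) (\<lambda>\<zeta>. f (b + \<zeta> *s u) y) 0) \<le> fact i * M / (r/2) ^ i"
    proof (rule Cauchy_deriv_bound[where a = 0 and r = r])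
      show "(\<lambda>\<zeta>. f (b + \<zeta> *s u) y) holomorphic_on ball 0 r"
        using line_hol that r R by simp
      fix z :: complex assume "z \<in> ball 0 r"
      then show "cmod (f (b + z *s u) y) \<le> M"
        using C[OF line_in[OF that(1)] that(2)] by (force simp: M_def)
    qed (use r in auto)
    then show ?thesis by (simp add: A_def norm_divide field_simps power_divide)
  qed
  have A2: "cmod (A i u y) \<le> M * (2 / R) ^ i" if "norm u \<le> 1" "y \<in> E m" for i u y
  proof -
    have y: "y \<in> cball q R" using that by (auto simp: E_def)
    have "cmod ((deriv ^^ i) (\<lambda>\<zeta>. f (b + \<zeta> *s u) y) 0) \<le> fact i * M / (R/2) ^ i"
    proof (rule Cauchy_deriv_bound[where a = 0 and r = R])
      show "(\<lambda>\<zeta>. f (b + \<zeta> *s u) y) holomorphic_on ball 0 R"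
        using line_hol that y R by simp
      fix z :: complex assume "z \<in> ball 0 R"
      then have "cmod (f (b + z *s u) y) \<le> real m"
        using line_in[OF that(1)] that(2) by (force simp: E_def)
      then show "cmod (f (b + z *s u) y) \<le> M" by (simp add: M_def)
    qed (use R in auto)
    then show ?thesis by (simp add: A_def norm_divide field_simps power_divide)
  qed
  \<comment> \<open>The uniform bound on the small ball allows differentiation with a parameter
    along coordinate lines in \<open>y\<close>, and \<open>A1\<close> supplies the local bound for
    Osgood's lemma.\<close>
  have A_hol: "holomorphic_on_vec (A i u) (ball q R)" if u: "norm u \<le> 1" for i u
  proof (rule osgood[OF open_ball])
    show "locally_bounded_on (A i u) (ball q R)"
      unfolding locally_bounded_on_def
    proof
      fix z assume "z \<in> ball q R"
      then obtain e where "e > 0" "ball z e \<subseteq> ball q R" using open_ball open_contains_ball by blast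
      then show "\<exists>e>0. \<exists>C. \<forall>w\<in>ball z e. cmod (A i u w) \<le> C"
        using A1[OF u] by (intro exI[of _ e] conjI exI[of _ "M * (2/r)^i"]) (auto simp: subset_iff)
    qed
    show "coord_holomorphic_on (A i u) (ball q R)"
      unfolding coord_holomorphic_on_def
    proof (intro ballI allI)
      fix y j assume y: "y \<in> ball q R"
      define T where "T = {\<eta>. y + \<eta> *s axis j 1 \<in> ball q R}"
      have T: "open T" unfolding T_def by (rule open_line_preimage[OF open_ball])
      have T0: "0 \<in> T" using y by (simp add: T_def)
      have "(\<lambda>\<eta>. (deriv ^^ i) (\<lambda>\<zeta>. f (b + \<zeta> *s u) (y + \<eta> *s axis j 1)) 0) holomorphic_on T"
      proof (rule holomorphic_higher_deriv_parameter[where S = "ball 0 r"])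
        fix a :: complex assume "a \<in> ball 0 r"
        then obtain e where e: "e > 0" "ball a e \<subseteq> ball 0 r" using open_ball open_contains_ball by blast
        have "\<forall>\<zeta>\<in>ball a e. \<forall>\<eta>\<in>T. cmod (f (b + \<zeta> *s u) (y + \<eta> *s axis j 1)) \<le> real k"
          using e(2) C[OF line_in[OF u]] by (force simp: T_def)
        then show "\<exists>e>0. \<exists>C. ball a e \<subseteq> ball 0 r \<and>
            (\<forall>\<zeta>\<in>ball a e. \<forall>\<eta>\<in>T. cmod (f (b + \<zeta> *s u) (y + \<eta> *s axis j 1)) \<le> C)"
          using e by blast
      next
        fix \<eta> assume "\<eta> \<in> T"
        then show "(\<lambda>\<zeta>. f (b + \<zeta> *s u) (y + \<eta> *s axis j 1)) holomorphic_on ball 0 r"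
          using line_hol[OF u] r R by (simp add: T_def)
      next
        fix \<zeta> :: complex assume "\<zeta> \<in> ball 0 r"
        then have "b + \<zeta> *s u \<in> X" using line_in[OF u, of \<zeta> r] bX r R by (auto simp: subset_iff)
        then show "(\<lambda>\<eta>. f (b + \<zeta> *s u) (y + \<eta> *s axis j 1)) holomorphic_on T"
          by (rule holomorphic_on_vec_line[OF hy]) (use qY in \<open>auto simp: T_def subset_iff\<close>)
      qed (use T r in auto)
      from holomorphic_on_imp_differentiable_at[OF this T T0]
      show "(\<lambda>\<eta>. A i u (y + axis j \<eta>)) field_differentiable at 0"
        unfolding A_def axis_smult[of j, symmetric] by (intro field_differentiable_divide) auto
    qed
  qed
  have A3: "cmod (A i u y) \<le> 2 * M * (8 / (3 * R)) ^ i" if u: "norm u \<le> 1" and y: "y \<in> cball q (R/4)" for i u y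
  proof -
    define \<alpha> where "\<alpha> = M * (2 / R) ^ i"
    define \<beta> where "\<beta> = M * (2 / r) ^ i"
    have M: "M > 0" by (simp add: M_def)
    have \<alpha>: "0 < \<alpha>" using M R by (simp add: \<alpha>_def)
    have sub: "cball y (R/2) \<subseteq> ball q R"
    proof
      fix z assume "z \<in> cball y (R/2)"
      then show "z \<in> ball q R" using y R dist_triangle[of q z y] by simp
    qed
    \<comment> \<open>The loss of a factor 2 is independent of \<open>i\<close>, so it does not
      affect the growth rate.\<close>
    have "cmod (A i u y) \<le> 2 * \<alpha> * (\<beta> / \<alpha>) powr \<epsilon>"
    proof (rule cmod_le_interpolation[OF A_hol[OF u] sub _ \<alpha>])
      show "\<alpha> \<le> \<beta>" unfolding \<alpha>_def \<beta>_def using M r R by (intro mult_left_mono power_mono) (auto simp: frac_le)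
      show "cmod (A i u z) \<le> \<beta>" if "z \<in> cball y (R/2)" for z
        unfolding \<beta>_def by (rule A1[OF u]) (use sub that in force)
      fix N :: nat assume N: "N > 0"
      obtain v where v: "norm v \<le> R/2"
        "real (card {j. j < N \<and> y + cis (2 * pi * real j / real N) *s v \<notin> E m}) \<le> \<epsilon> * real N"
        using m[OF y N] by blast
      have "card {j. j < N \<and> \<not> cmod (A i u (y + cis (2 * pi * real j / real N) *s v)) \<le> \<alpha>}
          \<le> card {j. j < N \<and> y + cis (2 * pi * real j / real N) *s v \<notin> E m}"
        by (rule card_mono) (use A2[OF u] in \<open>auto simp: \<alpha>_def\<close>)
      then show "\<exists>v. norm v \<le> R/2 \<and>
          real (card {j. j < N \<and> \<not> cmod (A i u (y + cis (2 * pi * real j / real N) *s v)) \<le> \<alpha>}) \<le> \<epsilon> * real N"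
        using v by (intro exI[of _ v]) linarith
    qed (use R in auto)
    also have "\<beta> / \<alpha> = (R / r) ^ i"
      using M R r by (simp add: \<alpha>_def \<beta>_def power_divide field_simps)
    also have "((R / r) ^ i) powr \<epsilon> = (4/3) ^ i"
    proof -
      have "((R / r) ^ i) powr \<epsilon> = ((R / r) powr \<epsilon>) ^ i"
        using R r by (simp add: powr_powr mult.commute flip: powr_realpow)
      then show ?thesis by (simp only: \<epsilon>(2))
    qed
    also have "2 * \<alpha> * (4/3) ^ i = 2 * M * (8 / (3 * R)) ^ i"
    proof -
      have "8 / (3 * R) = (2 / R) * (4 / 3)" by simp
      then show ?thesis by (simp only: \<alpha>_def power_mult_distrib mult.assoc)
    qed
    finally show ?thesis .
  qed
  have "cmod (f x y) \<le> 6 * M" if x: "x \<in> ball p (R/8)" and y: "y \<in> ball q (R/8)" for x y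
  proof -
    \<comment> \<open>Since \<open>x\<close> and \<open>b\<close> are both within \<open>R/8\<close>
      of \<open>p\<close>, this direction has norm at most 1 and \<open>x\<close> sits at parameter
      \<open>R/4\<close>.\<close>
    define u where "u = (4 / R) *\<^sub>R (x - b)"
    have "norm (x - b) \<le> R / 4"
      using x b norm_triangle_ineq[of "x - p" "p - b"] by (simp add: dist_norm norm_minus_commute)
    then have u: "norm u \<le> 1" using R by (simp add: u_def pos_divide_le_eq)
    have xu: "x = b + complex_of_real (R / 4) *s u"
      unfolding smult_of_real using R by (simp add: u_def)
    have y': "y \<in> cball q R" "y \<in> cball q (R/4)" using y R by auto
    have "(\<lambda>i. (deriv ^^ i) (\<lambda>\<zeta>. f (b + \<zeta> *s u) y) 0 / fact i * (complex_of_real (R/4) - 0) ^ i)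
        sums f (b + complex_of_real (R/4) *s u) y"
      by (rule holomorphic_power_series[OF line_hol[OF u y'(1) order_refl]]) (use R in \<open>simp add: norm_divide\<close>)
    then have s1: "(\<lambda>i. A i u y * complex_of_real (R/4) ^ i) sums f x y"
      unfolding xu[symmetric] A_def by simp
    have "(\<lambda>i. 2 * M * (2/3) ^ i) sums (2 * M * (1 / (1 - 2/3)))"
      by (intro sums_mult geometric_sums) auto
    then have s2: "(\<lambda>i. 2 * M * (2/3) ^ i) sums (6 * M)" by simp
    show ?thesis
    proof (rule norm_sums_le[OF s1 s2])
      fix i
      have "cmod (A i u y * complex_of_real (R/4) ^ i) = cmod (A i u y) * (R/4) ^ i"
        using R by (simp add: norm_mult norm_power norm_divide)
      also have "\<dots> \<le> 2 * M * (8 / (3 * R)) ^ i * (R/4) ^ i"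
        using R by (intro mult_right_mono A3 u y') auto
      also have "\<dots> = 2 * M * (2/3) ^ i"
        using R by (simp add: mult.assoc flip: power_mult_distrib)
      finally show "cmod (A i u y * complex_of_real (R/4) ^ i) \<le> 2 * M * (2/3) ^ i" .
    qed
  qed
  then show ?thesis using R by (intro exI[of _ "R/8"] conjI exI[of _ "6 * M"]) auto
qed

section \<open>Rescaling and the normalised modulus\<close>

lemma psd_kernel_hermitian:
  assumes "psd_kernel X K" "x \<in> X" "y \<in> X"
  shows "K y x = cnj (K x y)"
proof -
  have "psd_matrix 2 (\<lambda>i j. K (if i = 0 then x else y) (if j = 0 then x else y))"
    using assms unfolding psd_kernel_def by (elim allE[of _ 2] allE[of _ "\<lambda>i. if i = 0 then x else y"]) auto
  then have "\<forall>i<(2::nat). \<forall>j<(2::nat). K (if j = 0 then x else y) (if i = 0 then x else y)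
      = cnj (K (if i = 0 then x else y) (if j = 0 then x else y))"
    unfolding psd_matrix_def by blast
  from this[rule_format, of 0 1] show ?thesis by simp
qed

text \<open>Hermitean symmetry carries holomorphy in the first variable over to antiholomorphy in
  the second, so the statements below treat the first variable and are transferred.\<close>

locale hol_kernel =
  fixes X :: "(complex ^ 'n) set" and K :: "complex ^ 'n \<Rightarrow> complex ^ 'n \<Rightarrow> complex"
  assumes open_X: "open X" and connected_X: "connected X"
    and hol: "\<And>y. y \<in> X \<Longrightarrow> holomorphic_on_vec (\<lambda>x. K x y) X"
    and herm: "\<And>x y. x \<in> X \<Longrightarrow> y \<in> X \<Longrightarrow> K y x = cnj (K x y)"
    and diag: "\<And>x. x \<in> X \<Longrightarrow> K x x = of_real (kdiag K x)"
    and diag_pos: "\<And>x. x \<in> X \<Longrightarrow> 0 < kdiag K x"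
begin

lemma diag_nz: "x \<in> X \<Longrightarrow> K x x \<noteq> 0"
  using diag diag_pos by force

lemma cont: "y \<in> X \<Longrightarrow> continuous_on X (\<lambda>x. K x y)"
  by (rule holomorphic_on_vec_imp_continuous[OF hol])

lemma nz_nbhd:
  assumes "x \<in> X" "y \<in> X" "K x y \<noteq> 0"
  shows "\<exists>e>0. ball x e \<subseteq> X \<and> (\<forall>z\<in>ball x e. K z y \<noteq> 0)"
proof -
  have "open {z \<in> X. K z y \<noteq> 0}"
    using continuous_open_preimage[OF cont[OF assms(2)] open_X open_Compl[OF closed_singleton[of 0]]]
    by (simp add: vimage_def Int_def conj_commute)
  moreover have "x \<in> {z \<in> X. K z y \<noteq> 0}" using assms by simp
  ultimately obtain e where "e > 0" "ball x e \<subseteq> {z \<in> X. K z y \<noteq> 0}" by (meson open_contains_ball)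
  then show ?thesis by (intro exI[of _ e]) auto
qed

text \<open>If \<open>K\<close> with second argument \<open>p\<close> vanished on a ball, the
  identity theorem would spread the zero to \<open>p\<close> itself, where
  \<open>K p p \<noteq> 0\<close>.\<close>

lemma dense_nz:
  assumes "p \<in> X" "x \<in> X" "e > 0"
  shows "\<exists>q\<in>ball x e. q \<in> X \<and> K q p \<noteq> 0"
proof (rule ccontr)
  assume no: "\<not> ?thesis"
  obtain d where d: "d > 0" "ball x d \<subseteq> X" using open_X assms open_contains_ball by blast
  have "K p p = 0"
  proof (rule holomorphic_on_vec_eq_0[OF open_X connected_X hol[OF assms(1)] assms(2) _ _ assms(1)])
    show "min d e > 0" using d assms by simp
    show "K w p = 0" if "w \<in> ball x (min d e)" for w using no that d by auto
  qed
  then show False using diag_nz assms by blast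
qed

lemma eq_0_of_dense:
  assumes "continuous_on X h" "p \<in> X" "\<And>x. x \<in> X \<Longrightarrow> K x p \<noteq> 0 \<Longrightarrow> h x = (0::complex)" "x \<in> X"
  shows "h x = 0"
proof (rule ccontr)
  assume "h x \<noteq> 0"
  have "open {z \<in> X. h z \<noteq> 0}"
    using continuous_open_preimage[OF assms(1) open_X open_Compl[OF closed_singleton[of 0]]]
    by (simp add: vimage_def Int_def conj_commute)
  moreover have "x \<in> {z \<in> X. h z \<noteq> 0}" using assms \<open>h x \<noteq> 0\<close> by simp
  ultimately obtain e where e: "e > 0" "ball x e \<subseteq> {z \<in> X. h z \<noteq> 0}" by (meson open_contains_ball)
  obtain q where "q \<in> ball x e" "q \<in> X" "K q p \<noteq> 0" using dense_nz[OF assms(2,4) e(1)] by blast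
  then show False using assms(3)[of q] e by auto
qed

end

lemma holomorphic_on_vec_cmult: "holomorphic_on_vec f \<Omega> \<Longrightarrow> holomorphic_on_vec (\<lambda>x. f x * c) \<Omega>"
  unfolding holomorphic_on_vec_def
proof
  fix z assume "\<forall>z\<in>\<Omega>. \<exists>f'. (f has_derivative f') (at z) \<and> (\<forall>c v. f' (c *s v) = c * f' v)" "z \<in> \<Omega>"
  then obtain f' where "(f has_derivative f') (at z)" "\<forall>c v. f' (c *s v) = c * f' v" by blast
  then show "\<exists>f'. ((\<lambda>x. f x * c) has_derivative f') (at z) \<and> (\<forall>c v. f' (c *s v) = c * f' v)"
    by (intro exI[of _ "\<lambda>h. f' h * c"] conjI has_derivative_mult_left) auto
qed

lemma holomorphic_on_vec_mult:
  "holomorphic_on_vec f \<Omega> \<Longrightarrow> holomorphic_on_vec g \<Omega> \<Longrightarrow> holomorphic_on_vec (\<lambda>x. f x * g x) \<Omega>"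
  unfolding holomorphic_on_vec_def
proof
  fix z assume "\<forall>z\<in>\<Omega>. \<exists>f'. (f has_derivative f') (at z) \<and> (\<forall>c v. f' (c *s v) = c * f' v)"
    "\<forall>z\<in>\<Omega>. \<exists>f'. (g has_derivative f') (at z) \<and> (\<forall>c v. f' (c *s v) = c * f' v)" "z \<in> \<Omega>"
  then obtain f' g' where "(f has_derivative f') (at z)" "\<forall>c v. f' (c *s v) = c * f' v"
    "(g has_derivative g') (at z)" "\<forall>c v. g' (c *s v) = c * g' v" by blast
  then show "\<exists>f'. ((\<lambda>x. f x * g x) has_derivative f') (at z) \<and> (\<forall>c v. f' (c *s v) = c * f' v)"
    by (intro exI[of _ "\<lambda>h. f z * g' h + f' h * g z"] conjI has_derivative_mult) (auto simp: algebra_simps)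
qed

lemma holomorphic_on_vec_diff:
  "holomorphic_on_vec f \<Omega> \<Longrightarrow> holomorphic_on_vec g \<Omega> \<Longrightarrow> holomorphic_on_vec (\<lambda>x. f x - g x) \<Omega>"
  unfolding holomorphic_on_vec_def
proof
  fix z assume "\<forall>z\<in>\<Omega>. \<exists>f'. (f has_derivative f') (at z) \<and> (\<forall>c v. f' (c *s v) = c * f' v)"
    "\<forall>z\<in>\<Omega>. \<exists>f'. (g has_derivative f') (at z) \<and> (\<forall>c v. f' (c *s v) = c * f' v)" "z \<in> \<Omega>"
  then obtain f' g' where "(f has_derivative f') (at z)" "\<forall>c v. f' (c *s v) = c * f' v"
    "(g has_derivative g') (at z)" "\<forall>c v. g' (c *s v) = c * g' v" by blast
  then show "\<exists>f'. ((\<lambda>x. f x - g x) has_derivative f') (at z) \<and> (\<forall>c v. f' (c *s v) = c * f' v)"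
    by (intro exI[of _ "\<lambda>h. f' h - g' h"] conjI has_derivative_diff) (auto simp: algebra_simps)
qed

section \<open>The base-point identity and recovery of the rescaling factor\<close>

locale hol_kernel_pair = K: hol_kernel X K + L: hol_kernel X L
  for X :: "(complex ^ 'n) set" and K L
begin

text \<open>The difference of the two sides of the base-point identity. With the denominators
  cleared it is holomorphic in \<open>x\<close> on all of \<open>X\<close>, across the zeros of
  \<open>K x p\<close> and \<open>L x p\<close>.\<close>

definition cross :: "complex ^ 'n \<Rightarrow> complex ^ 'n \<Rightarrow> complex ^ 'n \<Rightarrow> complex" where
  "cross p x y = L x y * K x p * (K p y * L p p) - K x y * L x p * (L p y * K p p)"

lemma cross_holomorphic:
  "p \<in> X \<Longrightarrow> y \<in> X \<Longrightarrow> holomorphic_on_vec (\<lambda>x. cross p x y) X"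
  unfolding cross_def
  by (intro holomorphic_on_vec_diff holomorphic_on_vec_cmult holomorphic_on_vec_mult K.hol L.hol)

lemma cross_sym:
  assumes "p \<in> X" "x \<in> X" "y \<in> X"
  shows "cross p y x = cnj (cross p x y)"
  unfolding cross_def using assms
  by (simp add: K.herm[of x y] L.herm[of x y] K.herm[of y p] L.herm[of y p] K.herm[of p x] L.herm[of p x] 
      K.diag L.diag mult_ac)

lemma cross_eq_0_propagate:
  assumes "p \<in> X" "y \<in> X" "b \<in> X" "e > 0" "\<And>x. x \<in> ball b e \<Longrightarrow> cross p x y = 0" "x \<in> X"
  shows "cross p x y = 0"
  by (rule holomorphic_on_vec_eq_0[OF K.open_X K.connected_X cross_holomorphic[OF assms(1,2)] assms(3-6)])

text \<open>The zeros spread in \<open>x\<close> for \<open>y\<close> near \<open>p\<close>;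
  Hermitean symmetry exchanges the variables, and they spread in \<open>x\<close> once more, now for
  arbitrary \<open>y\<close>.\<close>

lemma cross_eq_0_global:
  assumes "p \<in> X" "e > 0" "ball p e \<subseteq> X" "\<And>x y. x \<in> ball p e \<Longrightarrow> y \<in> ball p e \<Longrightarrow> cross p x y = 0"
    and "x \<in> X" "y \<in> X"
  shows "cross p x y = 0"
proof -
  have 1: "cross p x y = 0" if "x \<in> X" "y \<in> ball p e" for x y
    by (rule cross_eq_0_propagate[OF assms(1) _ assms(1,2)]) (use that assms in auto)
  have 2: "cross p x y = 0" if "x \<in> ball p e" "y \<in> X" for x y
    using 1[OF that(2,1)] cross_sym[of p y x] that assms by auto
  show ?thesis
    by (rule cross_eq_0_propagate[OF assms(1,6,1,2) 2]) (use assms in auto)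
qed

text \<open>Where \<open>K x p \<noteq> 0\<close> the identity can be solved for
  \<open>L x y\<close> and gives the factor \<open>\<omega>0\<close>. Elsewhere the factor is forced
  by comparison with a point \<open>q x\<close> of the good set, and the rescaling identity is
  extended by density to one variable at a time (\<open>half\<close>, then
  \<open>full\<close>).\<close>

lemma rescallings_if_cross_eq_0:
  assumes p: "p \<in> X" and cross: "\<And>x y. x \<in> X \<Longrightarrow> y \<in> X \<Longrightarrow> cross p x y = 0"
  shows "rescallings X K L"
proof -
  \<comment> \<open>\<open>c\<^sup>2\<close> is the constant \<open>K p p / L p p\<close> left over
    when the identity is solved for \<open>L x y\<close>; its root is shared between
    \<open>\<omega>0 x\<close> and \<open>\<omega>0 y\<close>.\<close>
  define c where "c = sqrt (kdiag K p / kdiag L p)"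
  have c: "c > 0" "c\<^sup>2 = kdiag K p / kdiag L p"
    using K.diag_pos[OF p] L.diag_pos[OF p] by (auto simp: c_def)
  then have c2: "complex_of_real c * complex_of_real c = K p p / L p p"
    using K.diag[OF p] L.diag[OF p] by (metis of_real_divide of_real_mult power2_eq_square)
  have eq: "L x y * K x p * (K p y * L p p) = K x y * L x p * (L p y * K p p)" if "x \<in> X" "y \<in> X" for x y
    using cross[OF that] by (simp add: cross_def)
  have Lnz: "L x p \<noteq> 0" if "x \<in> X" "K x p \<noteq> 0" for x
  proof
    assume "L x p = 0"
    moreover have "K p x \<noteq> 0" using that K.herm[OF that(1) p] by simp
    ultimately show False
      using eq[OF that(1) that(1)] that L.diag_nz[OF that(1)] L.diag_nz[OF p] by simp
  qed
  define \<omega>0 where "\<omega>0 x = c * L x p / K x p" for x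
  have \<omega>0: "\<omega>0 x \<noteq> 0" if "x \<in> X" "K x p \<noteq> 0" for x using that Lnz[OF that] c by (simp add: \<omega>0_def)
  have base: "L x y = \<omega>0 x * cnj (\<omega>0 y) * K x y"
    if "x \<in> X" "K x p \<noteq> 0" "y \<in> X" "K y p \<noteq> 0" for x y
  proof -
    have Kpy: "K p y \<noteq> 0" using that K.herm[OF that(3) p] by simp
    have "cnj (\<omega>0 y) = c * L p y / K p y"
      using K.herm[OF that(3) p] L.herm[OF that(3) p] by (simp add: \<omega>0_def)
    then have "\<omega>0 x * cnj (\<omega>0 y) * K x y = (complex_of_real c * complex_of_real c) * (L x p / K x p) * (L p y / K p y) * K x y"
      by (simp add: \<omega>0_def)
    also have "\<dots> = L x y"
      unfolding c2 using eq[OF that(1,3)] that Kpy L.diag_nz[OF p] by (simp add: field_simps)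
    finally show ?thesis by simp
  qed
  \<comment> \<open>Near \<open>x\<close> the function \<open>K z x\<close> of \<open>z\<close> has
    no zero because \<open>K x x \<noteq> 0\<close>, and the good set is dense there.\<close>
  have "\<exists>q. q \<in> X \<and> K q p \<noteq> 0 \<and> K x q \<noteq> 0" if x: "x \<in> X" for x
  proof -
    obtain e where e: "e > 0" "\<forall>z\<in>ball x e. K z x \<noteq> 0" using K.nz_nbhd[OF x x K.diag_nz[OF x]] by blast
    obtain q where q: "q \<in> ball x e" "q \<in> X" "K q p \<noteq> 0" using K.dense_nz[OF p x e(1)] by blast
    then show ?thesis using e K.herm[OF q(2) x] by (intro exI[of _ q]) auto
  qed
  then obtain q where q: "\<And>x. x \<in> X \<Longrightarrow> q x \<in> X" "\<And>x. x \<in> X \<Longrightarrow> K (q x) p \<noteq> 0" "\<And>x. x \<in> X \<Longrightarrow> K x (q x) \<noteq> 0"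
    by metis
  define \<omega> where "\<omega> x = L x (q x) / (K x (q x) * cnj (\<omega>0 (q x)))" for x
  have half: "L x y = \<omega> x * cnj (\<omega>0 y) * K x y" if x: "x \<in> X" and y: "y \<in> X" "K y p \<noteq> 0" for x y
  proof -
    note qx = q[OF x]
    \<comment> \<open>At a good point \<open>z\<close> both products contain
      \<open>\<omega>0 z\<close> exactly once, so it cancels and what remains extends continuously
      to \<open>x\<close>.\<close>
    have "L x y * K x (q x) * cnj (\<omega>0 (q x)) - L x (q x) * K x y * cnj (\<omega>0 y) = 0"
    proof (rule K.eq_0_of_dense[where h = "\<lambda>z. L z y * K z (q x) * cnj (\<omega>0 (q x)) - L z (q x) * K z y * cnj (\<omega>0 y)", OF _ p _ x])
      show "continuous_on X (\<lambda>z. L z y * K z (q x) * cnj (\<omega>0 (q x)) - L z (q x) * K z y * cnj (\<omega>0 y))"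
        by (intro continuous_intros K.cont L.cont y qx)
      fix z assume z: "z \<in> X" "K z p \<noteq> 0"
      show "L z y * K z (q x) * cnj (\<omega>0 (q x)) - L z (q x) * K z y * cnj (\<omega>0 y) = 0"
        by (simp add: base[OF z y] base[OF z qx(1,2)])
    qed
    then show ?thesis using qx \<omega>0[OF qx(1,2)] by (simp add: \<omega>_def[of x] field_simps)
  qed
  have full: "L x y = \<omega> x * cnj (\<omega> y) * K x y" if x: "x \<in> X" and y: "y \<in> X" for x y
  proof -
    note qx = q[OF x]
    have "L x y * K x (q x) * cnj (\<omega>0 (q x)) - L x (q x) * K x y * cnj (\<omega> y) = 0"
    proof (rule K.eq_0_of_dense[where h = "\<lambda>z. L z y * K z (q x) * cnj (\<omega>0 (q x)) - L z (q x) * K z y * cnj (\<omega> y)", OF _ p _ x])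
      show "continuous_on X (\<lambda>z. L z y * K z (q x) * cnj (\<omega>0 (q x)) - L z (q x) * K z y * cnj (\<omega> y))"
        by (intro continuous_intros K.cont L.cont y qx)
      fix z assume z: "z \<in> X" "K z p \<noteq> 0"
      \<comment> \<open>\<open>half\<close> with exchanged variables: now \<open>y\<close> is
        arbitrary and \<open>z\<close> is good.\<close>
      have "L z y = cnj (\<omega> y) * \<omega>0 z * K z y"
        using half[OF y z] L.herm[OF y z(1)] K.herm[OF y z(1)] by simp
      then show "L z y * K z (q x) * cnj (\<omega>0 (q x)) - L z (q x) * K z y * cnj (\<omega> y) = 0"
        by (simp add: base[OF z qx(1,2)])
    qed
    then show ?thesis using qx \<omega>0[OF qx(1,2)] by (simp add: \<omega>_def[of x] field_simps)
  qed
  then show ?thesis unfolding rescallings_def by blast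
qed

lemma rescallings_nz:
  assumes "\<forall>x\<in>X. \<forall>y\<in>X. L x y = \<omega> x * cnj (\<omega> y) * K x y" "x \<in> X"
  shows "\<omega> x \<noteq> 0" "kdiag L x = (cmod (\<omega> x))\<^sup>2 * kdiag K x"
proof -
  have "L x x = \<omega> x * cnj (\<omega> x) * K x x" using assms by blast
  then have *: "complex_of_real (kdiag L x) = complex_of_real ((cmod (\<omega> x))\<^sup>2 * kdiag K x)"
    by (simp only: K.diag[OF assms(2)] L.diag[OF assms(2)] of_real_mult complex_norm_square)
  then show "kdiag L x = (cmod (\<omega> x))\<^sup>2 * kdiag K x" by (simp only: of_real_eq_iff)
  with L.diag_pos[OF assms(2)] show "\<omega> x \<noteq> 0" by auto
qed

lemma rescallings_imp_normalized_eq: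
  assumes "rescallings X K L" "x \<in> X" "y \<in> X"
  shows "(cmod (K x y))\<^sup>2 / (kdiag K x * kdiag K y) = (cmod (L x y))\<^sup>2 / (kdiag L x * kdiag L y)"
proof -
  obtain \<omega> where \<omega>: "\<forall>x\<in>X. \<forall>y\<in>X. L x y = \<omega> x * cnj (\<omega> y) * K x y"
    using assms(1) by (auto simp: rescallings_def)
  have "(cmod (L x y))\<^sup>2 = ((cmod (\<omega> x))\<^sup>2 * (cmod (\<omega> y))\<^sup>2) * (cmod (K x y))\<^sup>2"
    using \<omega> assms by (simp add: norm_mult power_mult_distrib)
  then show ?thesis
    using rescallings_nz[OF \<omega> assms(2)] rescallings_nz[OF \<omega> assms(3)] by (simp add: field_simps)
qed

text \<open>The quotient \<open>h\<close> is constant on each complex line through \<open>p\<close>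
  by the maximum principle, and the factors \<open>a\<close>, \<open>b\<close> free of
  \<open>x\<close> are arranged so that \<open>h p = 1\<close>. The condition
  \<open>K y p \<noteq> 0\<close> keeps the denominators away from 0 near \<open>p\<close>.\<close>

lemma cross_eq_0_near:
  assumes eq: "\<And>x y. x \<in> X \<Longrightarrow> y \<in> X \<Longrightarrow>
      (cmod (K x y))\<^sup>2 * (kdiag L x * kdiag L y) = (cmod (L x y))\<^sup>2 * (kdiag K x * kdiag K y)"
    and p: "p \<in> X" and y: "y \<in> X" "K y p \<noteq> 0"
  shows "\<exists>e>0. ball p e \<subseteq> X \<and> (\<forall>x\<in>ball p e. cross p x y = 0)"
proof -
  have KL: "L x y \<noteq> 0" if "x \<in> X" "y \<in> X" "K x y \<noteq> 0" for x y
    using eq[OF that(1,2)] that K.diag_pos[of x] K.diag_pos[of y] L.diag_pos[of x] L.diag_pos[of y] by auto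
  have Kpy: "K p y \<noteq> 0" using y K.herm[OF y(1) p] by simp
  obtain e1 where e1: "e1 > 0" "ball p e1 \<subseteq> X" "\<And>z. z\<in>ball p e1 \<Longrightarrow> K z y \<noteq> 0"
    using K.nz_nbhd[OF p y(1) Kpy] by blast
  obtain e2 where e2: "e2 > 0" "ball p e2 \<subseteq> X" "\<And>z. z\<in>ball p e2 \<Longrightarrow> K z p \<noteq> 0"
    using K.nz_nbhd[OF p p K.diag_nz[OF p]] by blast
  define e where "e = min e1 e2"
  have e: "e > 0" "ball p e \<subseteq> X" using e1 e2 by (auto simp: e_def)
  have nz: "z \<in> X \<and> K z y \<noteq> 0 \<and> K z p \<noteq> 0 \<and> L z y \<noteq> 0 \<and> L z p \<noteq> 0" if "z \<in> ball p e" for z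
    using that e e1 e2 KL[of z y] KL[of z p] p y by (auto simp: e_def subset_iff)
  define a where "a = K p y * L p p"
  define b where "b = L p y * K p p"
  have ab: "a \<noteq> 0" "b \<noteq> 0"
    using Kpy KL[OF p y(1) Kpy] K.diag_nz[OF p] L.diag_nz[OF p] by (auto simp: a_def b_def)
  define h where "h z = (L z y * K z p * a) / (K z y * L z p * b)" for z
  have h1: "cmod (h z) = 1" if z: "z \<in> ball p e" for z
  proof -
    note n = nz[OF z]
    have pos: "kdiag K z > 0" "kdiag L z > 0" "kdiag K y > 0" "kdiag L y > 0" "kdiag K p > 0" "kdiag L p > 0"
      using n y p K.diag_pos L.diag_pos by auto
    have r: "(cmod (L u v))\<^sup>2 = (cmod (K u v))\<^sup>2 * (kdiag L u * kdiag L v) / (kdiag K u * kdiag K v)"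
      if "u \<in> X" "v \<in> X" for u v
      using eq[OF that] K.diag_pos[OF that(1)] K.diag_pos[OF that(2)] by (simp add: field_simps)
    have pp: "cmod (K p p) = kdiag K p" "cmod (L p p) = kdiag L p"
      using K.diag[OF p] L.diag[OF p] pos by simp_all
    \<comment> \<open>After substitution of \<open>r\<close> all diagonal values cancel.\<close>
    have "(cmod (h z))\<^sup>2 = 1"
      unfolding h_def a_def b_def norm_divide norm_mult power_divide power_mult_distrib pp
      using n y p pos Kpy
      by (simp add: r[of z y] r[of z p] r[of p y]) (simp add: field_simps power2_eq_square)
    then show ?thesis by (simp add: power2_eq_1_iff) (smt (verit) norm_ge_zero)
  qed
  have "h x = h p" if x: "x \<in> ball p e" for x
  proof -
    define S where "S = {\<zeta>. p + \<zeta> *s (x - p) \<in> ball p e}"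
    have S: "open S" "connected S"
      unfolding S_def
      by (rule open_line_preimage[OF open_ball], intro convex_connected convex_line_preimage convex_ball)
    have S01: "0 \<in> S" "1 \<in> S" using x e by (auto simp: S_def)
    have SX: "p + \<zeta> *s (x - p) \<in> X" if "\<zeta> \<in> S" for \<zeta> using that e by (auto simp: S_def)
    have hS: "(\<lambda>\<zeta>. h (p + \<zeta> *s (x - p))) holomorphic_on S"
      unfolding h_def
      by (intro holomorphic_intros holomorphic_on_vec_line[OF K.hol] holomorphic_on_vec_line[OF L.hol] SX y p)
         (use nz ab in \<open>auto simp: S_def\<close>)
    have "(\<lambda>\<zeta>. h (p + \<zeta> *s (x - p))) constant_on S"
      by (rule maximum_modulus_principle[OF hS S S(1) order_refl S01(1)]) (use h1 S01 in \<open>auto simp: S_def simp del: mem_ball\<close>)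
    then show ?thesis using S01 unfolding constant_on_def by (metis add_diff_cancel_left' add.right_neutral diff_add_cancel vector_smult_lid vector_smult_lzero add.commute)
  qed
  moreover have "h p = 1"
    using Kpy ab K.diag_nz[OF p] L.diag_nz[OF p] KL[OF p y(1) Kpy] by (simp add: h_def a_def b_def)
  ultimately have "cross p x y = 0" if "x \<in> ball p e" for x
    using that nz[OF that] ab unfolding cross_def h_def a_def[symmetric] b_def[symmetric] by (auto simp: field_simps)
  then show ?thesis using e by blast
qed

text \<open>The condition \<open>K y p \<noteq> 0\<close> of the local statement is moved to
  \<open>x\<close> by symmetry, and continuity in \<open>x\<close> then fills in the zeros of
  \<open>K x p\<close>.\<close>

lemma rescallings_if_normalized_eq:
  assumes eq: "\<And>x y. x \<in> X \<Longrightarrow> y \<in> X \<Longrightarrow>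
      (cmod (K x y))\<^sup>2 / (kdiag K x * kdiag K y) = (cmod (L x y))\<^sup>2 / (kdiag L x * kdiag L y)"
  shows "rescallings X K L"
proof (cases "X = {}")
  case True
  then show ?thesis by (simp add: rescallings_def)
next
  case False
  then obtain p where p: "p \<in> X" by blast
  have eq': "(cmod (K x y))\<^sup>2 * (kdiag L x * kdiag L y) = (cmod (L x y))\<^sup>2 * (kdiag K x * kdiag K y)"
    if "x \<in> X" "y \<in> X" for x y
    using eq[OF that] K.diag_pos[OF that(1)] K.diag_pos[OF that(2)] L.diag_pos[OF that(1)] L.diag_pos[OF that(2)]
    by (simp add: field_simps)
  have 1: "cross p x y = 0" if x: "x \<in> X" and y: "y \<in> X" "K y p \<noteq> 0" for x y
  proof -
    obtain e where "e > 0" "\<And>x. x \<in> ball p e \<Longrightarrow> cross p x y = 0"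
      using cross_eq_0_near[OF eq' p y] by blast
    from cross_eq_0_propagate[OF p y(1) p this x] show ?thesis .
  qed
  have 2: "cross p x y = 0" if x: "x \<in> X" "K x p \<noteq> 0" and y: "y \<in> X" for x y
    using 1[OF y x] cross_sym[OF p y x(1)] by simp
  have 3: "cross p x y = 0" if x: "x \<in> X" and y: "y \<in> X" for x y
    by (rule K.eq_0_of_dense[OF holomorphic_on_vec_imp_continuous[OF cross_holomorphic[OF p y]] p 2[OF _ _ y] x])
  show ?thesis by (rule rescallings_if_cross_eq_0[OF p 3])
qed

text \<open>The real \<open>sqrt\<close> is an odd function and injective on all reals, so the sign
  of the radicand does not matter.\<close>

lemma delta1_eq_iff:
  "delta1 K x y = delta1 L x y \<longleftrightarrow>
     (cmod (K x y))\<^sup>2 / (kdiag K x * kdiag K y) = (cmod (L x y))\<^sup>2 / (kdiag L x * kdiag L y)"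
  by (simp add: delta1_def)

lemma delta2_eq_iff:
  assumes "x \<in> X" "y \<in> X"
  shows "delta2 K x y = delta2 L x y \<longleftrightarrow>
     (cmod (K x y))\<^sup>2 / (kdiag K x * kdiag K y) = (cmod (L x y))\<^sup>2 / (kdiag L x * kdiag L y)"
proof -
  have pos: "kdiag K x * kdiag K y > 0" "kdiag L x * kdiag L y > 0"
    using assms K.diag_pos L.diag_pos by auto
  have sq: "cmod z / sqrt d = sqrt ((cmod z)\<^sup>2 / d)" for z d
    by (simp add: real_sqrt_divide)
  show ?thesis
    unfolding delta2_def sq by simp
qed

theorem rescallings_iff_delta1: "rescallings X K L \<longleftrightarrow> (\<forall>x\<in>X. \<forall>y\<in>X. delta1 K x y = delta1 L x y)"
  unfolding delta1_eq_iff using rescallings_imp_normalized_eq rescallings_if_normalized_eq by blast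

theorem rescallings_iff_delta2: "rescallings X K L \<longleftrightarrow> (\<forall>x\<in>X. \<forall>y\<in>X. delta2 K x y = delta2 L x y)"
  using delta2_eq_iff rescallings_imp_normalized_eq rescallings_if_normalized_eq by blast

end

section \<open>Rescaling and the Hermitean form\<close>

text \<open>A polydisc. Being a product, \<open>cube (pair p p) r\<close> lets \<open>x\<close> and
  \<open>y\<close> range over \<open>cube p r\<close> independently, and it is convex.\<close>

definition cube :: "complex ^ 'm \<Rightarrow> real \<Rightarrow> (complex ^ 'm) set" where
  "cube a r = {z. \<forall>s. cmod (z $ s - a $ s) < r}"

lemma mem_cube: "z \<in> cube a r \<longleftrightarrow> (\<forall>s. cmod (z $ s - a $ s) < r)"
  by (simp add: cube_def)

lemma centre_in_cube: "r > 0 \<Longrightarrow> a \<in> cube a r"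
  by (simp add: cube_def)

lemma cube_mono: "r \<le> r' \<Longrightarrow> cube a r \<subseteq> cube a r'"
  by (auto simp: cube_def intro: less_le_trans)

lemma open_cube: "open (cube a r)"
proof -
  have "cube a r = (\<Inter>s. {z. cmod (z $ s - a $ s) < r})" by (auto simp: cube_def)
  then show ?thesis by (auto intro!: open_INT open_Collect_less continuous_intros)
qed

lemma convex_cube: "convex (cube a r)"
proof -
  have "cube a r = (\<Inter>s. (\<lambda>z. z $ s) -` (ball (a $ s) r))"
    by (auto simp: cube_def dist_norm norm_minus_commute)
  then show ?thesis
    by (auto intro!: convex_INT convex_linear_vimage bounded_linear.linear[OF bounded_linear_vec_nth] simp del: mem_ball)
qed

lemma ball_subset_cube: "ball a r \<subseteq> cube a r"
proof
  fix z assume "z \<in> ball a r"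
  then have "norm (z - a) < r" by (simp add: dist_norm norm_minus_commute)
  then show "z \<in> cube a r"
    using Finite_Cartesian_Product.norm_nth_le[of "z - a"] by (auto simp: cube_def intro: le_less_trans)
qed

lemma cube_subset_ball:
  fixes a :: "complex ^ 'm"
  assumes "e > 0"
  obtains r where "r > 0" "cube a r \<subseteq> ball a e"
proof
  let ?r = "e / real CARD('m)"
  show "?r > 0" using assms by simp
  show "cube a ?r \<subseteq> ball a e"
  proof
    fix z assume z: "z \<in> cube a ?r"
    have "norm (z - a) \<le> (\<Sum>s\<in>UNIV. cmod ((z - a) $ s))"
      unfolding norm_vec_def by (rule L2_set_le_sum) auto
    also have "\<dots> < (\<Sum>s\<in>(UNIV::'m set). ?r)"
      by (rule sum_strict_mono) (use z in \<open>auto simp: cube_def\<close>)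
    finally show "z \<in> ball a e" by (simp add: dist_norm norm_minus_commute)
  qed
qed

section \<open>Polarisation: functions near the diagonal in doubled variables\<close>

text \<open>Conjugating the second component makes the polarised kernel holomorphic in all variables.\<close>

definition pair :: "complex ^ 'n \<Rightarrow> complex ^ 'n \<Rightarrow> complex ^ ('n::finite + 'n)" where
  "pair x y = (\<chi> s. case s of Inl i \<Rightarrow> x $ i | Inr i \<Rightarrow> cnj (y $ i))"

definition fstv :: "complex ^ ('n::finite + 'n) \<Rightarrow> complex ^ 'n" where
  "fstv Z = (\<chi> i. Z $ Inl i)"

definition sndv :: "complex ^ ('n::finite + 'n) \<Rightarrow> complex ^ 'n" where
  "sndv Z = (\<chi> i. cnj (Z $ Inr i))"

definition cnjv :: "complex ^ 'n \<Rightarrow> complex ^ 'n" where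
  "cnjv x = (\<chi> i. cnj (x $ i))"

lemma pair_nth [simp]: "pair x y $ Inl i = x $ i" "pair x y $ Inr i = cnj (y $ i)"
  by (simp_all add: pair_def)

lemma fstv_pair [simp]: "fstv (pair x y) = x"
  and sndv_pair [simp]: "sndv (pair x y) = y"
  by (simp_all add: fstv_def sndv_def vec_eq_iff)

lemma vec_sum_eq_iff: "(Z :: complex ^ ('n::finite + 'n)) = W \<longleftrightarrow> (\<forall>i. Z $ Inl i = W $ Inl i) \<and> (\<forall>i. Z $ Inr i = W $ Inr i)"
  by (auto simp: vec_eq_iff) (metis sum.exhaust)

lemma cnjv_cnjv [simp]: "cnjv (cnjv x) = x"
  by (simp add: cnjv_def vec_eq_iff)

lemma norm_cnjv [simp]: "norm (cnjv x) = norm x"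
  by (simp add: norm_vec_def cnjv_def)

lemma bounded_linear_cnjv: "bounded_linear cnjv"
proof -
  have "linear cnjv" by (rule linearI) (simp_all add: cnjv_def vec_eq_iff)
  then show ?thesis by (simp add: linear_conv_bounded_linear)
qed

lemma cnjv_smult: "cnjv (c *s v) = cnj c *s cnjv v"
  by (simp add: cnjv_def vec_eq_iff)

lemma bounded_linear_pair_diag: "bounded_linear (\<lambda>w. pair w w)"
proof -
  have "linear (\<lambda>w. pair w w)" by (rule linearI) (simp_all add: vec_sum_eq_iff)
  then show ?thesis by (simp add: linear_conv_bounded_linear)
qed

lemma mem_cube_pair:
  "Z \<in> cube (pair p p) r \<longleftrightarrow> fstv Z \<in> cube p r \<and> sndv Z \<in> cube p r"
proof -
  have "cmod (Z $ Inr i - cnj (p $ i)) = cmod (cnj (Z $ Inr i) - p $ i)" for i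
    by (metis complex_cnj_cnj complex_cnj_diff complex_mod_cnj)
  then show ?thesis by (simp add: mem_cube fstv_def sndv_def split_sum_all)
qed

lemma pair_mem_cube [simp]: "pair x y \<in> cube (pair p p) r \<longleftrightarrow> x \<in> cube p r \<and> y \<in> cube p r"
  by (simp add: mem_cube_pair)

text \<open>Conjugating argument and value, as in the reflection principle, conjugates the scalar
  twice, so the derivative remains complex linear.\<close>

lemma holomorphic_on_vec_cnj:
  assumes g: "holomorphic_on_vec g X"
  shows "holomorphic_on_vec (\<lambda>y. cnj (g (cnjv y))) {y. cnjv y \<in> X}"
  unfolding holomorphic_on_vec_def
proof
  fix y assume "y \<in> {y. cnjv y \<in> X}"
  then obtain g' where g': "(g has_derivative g') (at (cnjv y))" "\<And>c v. g' (c *s v) = c * g' v"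
    using g by (auto simp: holomorphic_on_vec_def)
  have "((\<lambda>y. g (cnjv y)) has_derivative (\<lambda>h. g' (cnjv h))) (at y)"
    by (rule has_derivative_compose[OF bounded_linear_imp_has_derivative[OF bounded_linear_cnjv] g'(1)])
  then have "((\<lambda>y. cnj (g (cnjv y))) has_derivative (\<lambda>h. cnj (g' (cnjv h)))) (at y)"
    by (rule bounded_linear.has_derivative[OF bounded_linear_cnj])
  then show "\<exists>f'. ((\<lambda>y. cnj (g (cnjv y))) has_derivative f') (at y) \<and> (\<forall>c v. f' (c *s v) = c * f' v)"
    by (intro exI[of _ "\<lambda>h. cnj (g' (cnjv h))"] conjI) (auto simp: cnjv_smult g'(2))
qed

lemma holomorphic_on_vec_Ln:
  assumes g: "holomorphic_on_vec g X" and pos: "\<And>z. z \<in> X \<Longrightarrow> 0 < Re (g z)"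
  shows "holomorphic_on_vec (\<lambda>z. Ln (g z)) X"
  unfolding holomorphic_on_vec_def
proof
  fix z assume z: "z \<in> X"
  then obtain g' where g': "(g has_derivative g') (at z)" "\<And>c v. g' (c *s v) = c * g' v"
    using g by (auto simp: holomorphic_on_vec_def)
  have "g z \<notin> \<real>\<^sub>\<le>\<^sub>0" using pos[OF z] by (auto simp: complex_nonpos_Reals_iff)
  then have "(Ln has_derivative (*) (inverse (g z))) (at (g z))"
    using has_field_derivative_Ln by (simp add: has_field_derivative_def)
  from has_derivative_compose[OF g'(1) this]
  show "\<exists>f'. ((\<lambda>z. Ln (g z)) has_derivative f') (at z) \<and> (\<forall>c v. f' (c *s v) = c * f' v)"
    by (intro exI[of _ "\<lambda>h. inverse (g z) * g' h"] conjI) (auto simp: g'(2))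
qed

lemma pd_cong:
  assumes "open \<Omega>" "z \<in> \<Omega>" "\<And>w. w \<in> \<Omega> \<Longrightarrow> f w = g w"
  shows "pd k f z = pd k g z"
  unfolding pd_def
proof (rule deriv_cong_ev)
  have "open {\<zeta>. z + \<zeta> *s axis k 1 \<in> \<Omega>}" by (rule open_line_preimage[OF assms(1)])
  then have "\<forall>\<^sub>F \<zeta> in nhds 0. z + \<zeta> *s axis k 1 \<in> \<Omega>"
    using assms(2) eventually_nhds_in_open[of "{\<zeta>. z + \<zeta> *s axis k 1 \<in> \<Omega>}" 0] by simp
  then show "\<forall>\<^sub>F \<zeta> in nhds 0. f (z + axis k \<zeta>) = g (z + axis k \<zeta>)"
    by eventually_elim (simp add: assms(3) flip: axis_smult)
qed simp

lemma pd_diff: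
  assumes "holomorphic_on_vec f \<Omega>" "holomorphic_on_vec g \<Omega>" "z \<in> \<Omega>"
  shows "pd k (\<lambda>w. f w - g w) z = pd k f z - pd k g z"
  unfolding pd_def using assms holomorphic_on_vec_imp_coord[OF assms(1)] holomorphic_on_vec_imp_coord[OF assms(2)]
  by (intro deriv_diff) (auto simp: coord_holomorphic_on_def)

lemma sum_UNIV_sum: "(\<Sum>s\<in>UNIV. h s) = (\<Sum>i\<in>UNIV. h (Inl i)) + (\<Sum>i\<in>UNIV. h (Inr i))"
  for h :: "'n::finite + 'n \<Rightarrow> complex"
  by (subst UNIV_sum, subst sum.union_disjoint) (auto simp: sum.reindex)

lemma dir_deriv_pair:
  assumes Q: "holomorphic_on_vec Q \<Omega>" and z: "pair z z \<in> \<Omega>"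
    and U: "open U" "z \<in> U" "\<And>w. w \<in> U \<Longrightarrow> f w = Q (pair w w)"
  shows "dir_deriv v f z = (\<Sum>s\<in>UNIV. pair v v $ s * pd s Q (pair z z))"
proof -
  have "((\<lambda>w. Q (pair w w)) has_derivative (\<lambda>h. \<Sum>s\<in>UNIV. pair h h $ s * pd s Q (pair z z))) (at z)"
    by (rule has_derivative_compose[OF bounded_linear_imp_has_derivative[OF bounded_linear_pair_diag]
        holomorphic_on_vec_derivative[OF Q z]])
  then have "(f has_derivative (\<lambda>h. \<Sum>s\<in>UNIV. pair h h $ s * pd s Q (pair z z))) (at z)"
    by (rule has_derivative_transform_within_open[OF _ U(1,2)]) (simp add: U(3))
  then have f: "(f has_derivative (\<lambda>h. \<Sum>s\<in>UNIV. pair h h $ s * pd s Q (pair z z))) (at (z + 0 *\<^sub>R v))"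
    by simp
  have "((\<lambda>t. z + t *\<^sub>R v) has_derivative (\<lambda>t. t *\<^sub>R v)) (at (0::real))"
    by (auto intro!: derivative_eq_intros)
  from has_derivative_compose[OF this f]
  have "((\<lambda>t. f (z + t *\<^sub>R v)) has_derivative (\<lambda>t. \<Sum>s\<in>UNIV. pair (t *\<^sub>R v) (t *\<^sub>R v) $ s * pd s Q (pair z z))) (at (0::real))" .
  moreover have "(\<Sum>s\<in>UNIV. pair (t *\<^sub>R v) (t *\<^sub>R v) $ s * pd s Q (pair z z))
      = t *\<^sub>R (\<Sum>s\<in>UNIV. pair v v $ s * pd s Q (pair z z))" for t :: real
    by (simp add: linear_scale[OF bounded_linear.linear[OF bounded_linear_pair_diag]] scaleR_sum_right)
  ultimately show ?thesis
    unfolding dir_deriv_def by (intro vector_derivative_at) (simp add: has_vector_derivative_def)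
qed

text \<open>In direction \<open>axis j c\<close> the chain rule gives \<open>c\<close> times the
  \<open>Inl j\<close> derivative plus \<open>cnj c\<close> times the \<open>Inr j\<close>
  derivative; the Wirtinger combinations of \<open>c = 1\<close> and \<open>c = \<i>\<close> isolate
  one of the two.\<close>

lemma d_z_pair:
  assumes Q: "holomorphic_on_vec Q \<Omega>" and z: "pair z z \<in> \<Omega>"
    and U: "open U" "z \<in> U" "\<And>w. w \<in> U \<Longrightarrow> f w = Q (pair w w)"
  shows "d_z j f z = pd (Inl j) Q (pair z z)" "d_zbar j f z = pd (Inr j) Q (pair z z)"
proof -
  have "dir_deriv (axis j c) f z = c * pd (Inl j) Q (pair z z) + cnj c * pd (Inr j) Q (pair z z)" for c
  proof -
    have ax: "axis j c $ i * b = (if i = j then c * b else 0)" "cnj (axis j c $ i) * b = (if i = j then cnj c * b else 0)" for i b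
      by (simp_all add: axis_def)
    show ?thesis
      by (subst dir_deriv_pair[OF Q z U]) (simp_all add: sum_UNIV_sum ax)
  qed
  then show "d_z j f z = pd (Inl j) Q (pair z z)" "d_zbar j f z = pd (Inr j) Q (pair z z)"
    by (simp_all add: d_z_def d_zbar_def algebra_simps)
qed

text \<open>The complex line \<open>pair a a + \<zeta> *s pair b b\<close> through \<open>Z\<close> meets the diagonal whenever \<open>\<zeta>\<close> is real.\<close>

lemma holomorphic_eq_0_of_diagonal:
  assumes g: "holomorphic_on_vec g (cube (pair p p) r)"
    and diag: "\<And>w. w \<in> cube p r \<Longrightarrow> g (pair w w) = 0" and Z: "Z \<in> cube (pair p p) r"
  shows "g Z = 0"
proof -
  define x where "x = fstv Z"
  define y where "y = sndv Z"
  have xy: "x \<in> cube p r" "y \<in> cube p r" using Z by (simp_all add: mem_cube_pair x_def y_def)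
  \<comment> \<open>\<open>a\<close> and \<open>b\<close> solve \<open>a + \<i> b = x\<close> and
    \<open>a - \<i> b = y\<close>, so \<open>Z\<close> is the point of the line with parameter
    \<open>\<i>\<close>.\<close>
  define a where "a = (1/2) *s (x + y)"
  define b where "b = (- \<i> / 2) *s (x - y)"
  define S where "S = {\<zeta>. pair a a + \<zeta> *s pair b b \<in> cube (pair p p) r}"
  have Zi: "Z = pair a a + \<i> *s pair b b"
    by (simp add: vec_sum_eq_iff a_def b_def x_def y_def fstv_def sndv_def field_simps)
  have "a = (1/2) *\<^sub>R x + (1/2) *\<^sub>R y"
    by (simp add: a_def vec_eq_iff scaleR_conv_of_real[where 'a = complex] algebra_simps)
  then have "a \<in> cube p r" using convexD[OF convex_cube xy, of "1/2" "1/2"] by simp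
  then have "0 \<in> S" by (simp add: S_def)
  have "open S" unfolding S_def by (rule open_line_preimage[OF open_cube])
  have "connected S" unfolding S_def by (intro convex_connected convex_line_preimage convex_cube)
  define U where "U = {\<zeta> \<in> S. \<zeta> \<in> \<real>}"
  have "(0::complex) islimpt U"
    unfolding islimpt_approachable
  proof (intro allI impI)
    fix e :: real assume e: "e > 0"
    obtain d where d: "d > 0" "ball 0 d \<subseteq> S" using \<open>open S\<close> \<open>0 \<in> S\<close> open_contains_ball by blast
    have "complex_of_real (min e d / 2) \<in> U" using d e by (auto simp: U_def subset_iff)
    then show "\<exists>x'\<in>U. x' \<noteq> 0 \<and> dist x' 0 < e"
      using d e by (intro bexI[of _ "complex_of_real (min e d / 2)"]) (auto simp: min_def)
  qed
  have "(\<lambda>\<zeta>. g (pair a a + \<zeta> *s pair b b)) \<i> = 0"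
  proof (rule analytic_continuation[where f = "\<lambda>\<zeta>. g (pair a a + \<zeta> *s pair b b)" and S = S and U = U and \<xi> = 0])
    show "(\<lambda>\<zeta>. g (pair a a + \<zeta> *s pair b b)) holomorphic_on S"
      by (rule holomorphic_on_vec_line[OF g]) (simp add: S_def)
    show "\<i> \<in> S" using Z Zi by (simp add: S_def)
    fix \<zeta> assume "\<zeta> \<in> U"
    then obtain t where t: "\<zeta> = complex_of_real t" "\<zeta> \<in> S" by (auto simp: U_def Reals_def)
    have "pair a a + \<zeta> *s pair b b = pair (a + t *\<^sub>R b) (a + t *\<^sub>R b)"
      by (simp add: vec_sum_eq_iff t(1) scaleR_conv_of_real[where 'a = complex])
    then show "g (pair a a + \<zeta> *s pair b b) = 0" using diag t(2) by (simp add: S_def)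
  qed (use \<open>0 \<in> S\<close> \<open>open S\<close> \<open>connected S\<close> \<open>0 islimpt U\<close> in \<open>auto simp: U_def\<close>)
  then show ?thesis by (simp add: Zi)
qed

section \<open>Polarised kernels and the coefficients of the form\<close>

context hol_kernel
begin

definition polar :: "complex ^ ('n + 'n) \<Rightarrow> complex" where
  "polar Z = K (fstv Z) (sndv Z)"

lemma polar_pair [simp]: "polar (pair x y) = K x y"
  by (simp add: polar_def)

text \<open>Hartogs' theorem for \<open>K x (cnjv y)\<close> bounds \<open>polar\<close> near
  \<open>pair p p\<close>, and Osgood's lemma makes it jointly holomorphic there. The polydisc is
  shrunk further to keep the values in the right half-plane, where \<open>Ln\<close> is
  holomorphic.\<close>

lemma polar_locally_holomorphic:
  assumes p: "p \<in> X"
  shows "\<exists>r>0. cube p r \<subseteq> X \<and> holomorphic_on_vec polar (cube (pair p p) r) \<and>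
    (\<forall>Z\<in>cube (pair p p) r. 0 < Re (polar Z))"
proof -
  define f where "f x y = K x (cnjv y)" for x y
  have opY: "open {y. cnjv y \<in> X}"
    using open_vimage[OF open_X linear_continuous_on[OF bounded_linear_cnjv]] by (simp add: vimage_def)
  have hy: "holomorphic_on_vec (f x) {y. cnjv y \<in> X}" if x: "x \<in> X" for x
  proof -
    have "f x y = cnj (K (cnjv y) x)" if "cnjv y \<in> X" for y
      using herm[OF that x] by (simp add: f_def)
    moreover have "holomorphic_on_vec (\<lambda>y. cnj (K (cnjv y) x)) {y. cnjv y \<in> X}"
      by (rule holomorphic_on_vec_cnj[OF hol[OF x]])
    ultimately show ?thesis
      unfolding holomorphic_on_vec_def
      by (metis (mono_tags, lifting) has_derivative_transform_within_open mem_Collect_eq opY)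
  qed
  have hx: "holomorphic_on_vec (\<lambda>x. f x y) X" if "y \<in> {y. cnjv y \<in> X}" for y
    unfolding f_def by (rule hol) (use that in simp)
  have "\<exists>e>0. \<exists>C. \<forall>x\<in>ball p e. \<forall>y\<in>ball (cnjv p) e. cmod (f x y) \<le> C"
    by (rule hartogs_locally_bounded[OF open_X opY hx hy p]) (use p in simp_all)
  then obtain e C where e: "e > 0" and C: "\<And>x y. x \<in> ball p e \<Longrightarrow> y \<in> ball (cnjv p) e \<Longrightarrow> cmod (f x y) \<le> C"
    by blast
  obtain e' where e': "e' > 0" "ball p e' \<subseteq> X" using open_X p open_contains_ball by blast
  have "min e e' > 0" using e e' by simp
  then obtain r where r: "r > 0" "cube p r \<subseteq> ball p (min e e')"
    using cube_subset_ball by blast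
  have re: "cube p r \<subseteq> ball p e"
    using r(2) subset_ball[of "min e e'" e p] by simp
  have rX: "cube p r \<subseteq> X"
    using r(2) e'(2) subset_ball[of "min e e'" e' p] by simp
  have "holomorphic_on_vec polar (cube (pair p p) r)"
  proof (rule osgood[OF open_cube])
    show "locally_bounded_on polar (cube (pair p p) r)"
      unfolding locally_bounded_on_def
    proof
      fix Z assume "Z \<in> cube (pair p p) r"
      then obtain d where d: "d > 0" "ball Z d \<subseteq> cube (pair p p) r"
        using open_cube open_contains_ball by blast
      have "cmod (polar W) \<le> C" if "W \<in> cube (pair p p) r" for W
      proof -
        have "fstv W \<in> ball p e" "sndv W \<in> ball p e"
          using that re by (auto simp: mem_cube_pair simp del: mem_ball)
        moreover have "dist (cnjv p) (cnjv (sndv W)) = dist p (sndv W)"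
          unfolding dist_norm linear_diff[OF bounded_linear.linear[OF bounded_linear_cnjv], symmetric] by (rule norm_cnjv)
        ultimately show ?thesis using C[of "fstv W" "cnjv (sndv W)"] by (simp add: polar_def f_def)
      qed
      then show "\<exists>e>0. \<exists>C. \<forall>w\<in>ball Z e. cmod (polar w) \<le> C" using d by blast
    qed
    show "coord_holomorphic_on polar (cube (pair p p) r)"
      unfolding coord_holomorphic_on_def
    proof (intro ballI allI)
      fix Z s assume "Z \<in> cube (pair p p) r"
      then have Z: "fstv Z \<in> X" "sndv Z \<in> X" using rX by (auto simp: mem_cube_pair)
      show "(\<lambda>\<zeta>. polar (Z + axis s \<zeta>)) field_differentiable at 0"
      proof (cases s)
        case (Inl k)
        have "fstv (Z + axis s \<zeta>) = fstv Z + axis k \<zeta>" "sndv (Z + axis s \<zeta>) = sndv Z" for \<zeta>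
          by (auto simp: Inl fstv_def sndv_def vec_eq_iff axis_def)
        then show ?thesis
          using holomorphic_on_vec_imp_coord[OF hol[OF Z(2)]] Z
          by (simp add: polar_def coord_holomorphic_on_def)
      next
        case (Inr k)
        have "fstv (Z + axis s \<zeta>) = fstv Z" "sndv (Z + axis s \<zeta>) = cnjv (cnjv (sndv Z) + axis k \<zeta>)" for \<zeta>
          by (auto simp: Inr fstv_def sndv_def vec_eq_iff axis_def cnjv_def)
        then show ?thesis
          using holomorphic_on_vec_imp_coord[OF hy[OF Z(1)]] Z
          by (simp add: polar_def coord_holomorphic_on_def f_def)
      qed
    qed
  qed
  note H = this
  have "open {Z \<in> cube (pair p p) r. polar Z \<in> {z. 0 < Re z}}"
    using continuous_open_preimage[OF holomorphic_on_vec_imp_continuous[OF H] open_cube open_halfspace_Re_gt[of 0]]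
    by (simp add: vimage_def Int_def)
  moreover have "pair p p \<in> {Z \<in> cube (pair p p) r. polar Z \<in> {z. 0 < Re z}}"
    using diag[OF p] diag_pos[OF p] r centre_in_cube[OF r(1)] by simp
  ultimately obtain d where d: "d > 0" "ball (pair p p) d \<subseteq> {Z \<in> cube (pair p p) r. polar Z \<in> {z. 0 < Re z}}"
    by (meson open_contains_ball)
  obtain r' where r': "r' > 0" "cube (pair p p) r' \<subseteq> ball (pair p p) d"
    using cube_subset_ball[OF d(1)] by blast
  show ?thesis
  proof (intro exI[of _ "min r r'"] conjI)
    have sub: "cube (pair p p) (min r r') \<subseteq> cube (pair p p) r" "cube (pair p p) (min r r') \<subseteq> cube (pair p p) r'"
      by (simp_all add: cube_mono)
    show "holomorphic_on_vec polar (cube (pair p p) (min r r'))"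
      by (rule holomorphic_on_vec_subset[OF H sub(1)])
    show "\<forall>Z\<in>cube (pair p p) (min r r'). 0 < Re (polar Z)"
      using sub(2) r' d by blast
    show "cube p (min r r') \<subseteq> X" using cube_mono[of "min r r'" r p] rX by auto
  qed (use r r' in simp)
qed

text \<open>On the diagonal \<open>Ln (polar (pair w w))\<close> is the potential. Its
  \<open>zbar\<close> derivative is again a holomorphic function of \<open>pair w w\<close> on the
  whole cube, so Wirtinger derivatives can be replaced by partial ones twice.\<close>

lemma sigma_form_eq:
  assumes rX: "cube p r \<subseteq> X" and H: "holomorphic_on_vec polar (cube (pair p p) r)"
    and pos: "\<And>Z. Z \<in> cube (pair p p) r \<Longrightarrow> 0 < Re (polar Z)" and z: "z \<in> cube p r"
  shows "sigma_form K z u v = (\<Sum>j\<in>UNIV. \<Sum>k\<in>UNIV.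
    pd (Inl j) (pd (Inr k) (\<lambda>Z. Ln (polar Z))) (pair z z) * (u $ j * cnj (v $ k)))"
proof -
  have P: "holomorphic_on_vec (\<lambda>Z. Ln (polar Z)) (cube (pair p p) r)"
    by (rule holomorphic_on_vec_Ln[OF H pos])
  have log: "complex_of_real (ln (kdiag K w)) = Ln (polar (pair w w))" if "w \<in> cube p r" for w
    using rX that diag[of w] diag_pos[of w] by (auto simp: Ln_of_real)
  have "d_zbar k (\<lambda>w. complex_of_real (ln (kdiag K w))) w = pd (Inr k) (\<lambda>Z. Ln (polar Z)) (pair w w)"
    if "w \<in> cube p r" for w k
    by (rule d_z_pair(2)[OF P _ open_cube that log]) (use that in simp_all)
  then have "d_z j (d_zbar k (\<lambda>w. complex_of_real (ln (kdiag K w)))) z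
      = pd (Inl j) (pd (Inr k) (\<lambda>Z. Ln (polar Z))) (pair z z)" for j k
    using d_z_pair(1)[OF holomorphic_on_vec_pd[OF open_cube P] _ open_cube z] z by simp
  then show ?thesis by (simp add: sigma_form_def)
qed

end

section \<open>The logarithm of the ratio of two kernels\<close>

context hol_kernel_pair
begin

text \<open>As a difference of two logarithms it has mixed derivatives on the diagonal equal to the
  differences of the coefficients of the two forms.\<close>

definition log_ratio :: "complex ^ ('n + 'n) \<Rightarrow> complex" where
  "log_ratio Z = Ln (L.polar Z) - Ln (K.polar Z)"

lemma common_cube:
  assumes p: "p \<in> X"
  obtains r where "r > 0" "cube p r \<subseteq> X"
    "holomorphic_on_vec K.polar (cube (pair p p) r)" "\<And>Z. Z \<in> cube (pair p p) r \<Longrightarrow> 0 < Re (K.polar Z)"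
    "holomorphic_on_vec L.polar (cube (pair p p) r)" "\<And>Z. Z \<in> cube (pair p p) r \<Longrightarrow> 0 < Re (L.polar Z)"
proof -
  obtain r1 where r1: "r1 > 0" "cube p r1 \<subseteq> X"
    "holomorphic_on_vec K.polar (cube (pair p p) r1)" "\<forall>Z\<in>cube (pair p p) r1. 0 < Re (K.polar Z)"
    using K.polar_locally_holomorphic[OF p] by blast
  obtain r2 where r2: "r2 > 0" "cube p r2 \<subseteq> X"
    "holomorphic_on_vec L.polar (cube (pair p p) r2)" "\<forall>Z\<in>cube (pair p p) r2. 0 < Re (L.polar Z)"
    using L.polar_locally_holomorphic[OF p] by blast
  have sub: "cube (pair p p) (min r1 r2) \<subseteq> cube (pair p p) r1" "cube (pair p p) (min r1 r2) \<subseteq> cube (pair p p) r2"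
    "cube p (min r1 r2) \<subseteq> cube p r1"
    by (simp_all add: cube_mono)
  show thesis
  proof (rule that[of "min r1 r2"])
    show "cube p (min r1 r2) \<subseteq> X" using sub(3) r1(2) by blast
    show "holomorphic_on_vec K.polar (cube (pair p p) (min r1 r2))"
      by (rule holomorphic_on_vec_subset[OF r1(3) sub(1)])
    show "holomorphic_on_vec L.polar (cube (pair p p) (min r1 r2))"
      by (rule holomorphic_on_vec_subset[OF r2(3) sub(2)])
    show "0 < Re (K.polar Z)" if "Z \<in> cube (pair p p) (min r1 r2)" for Z
      using r1(4) sub(1) that by blast
    show "0 < Re (L.polar Z)" if "Z \<in> cube (pair p p) (min r1 r2)" for Z
      using r2(4) sub(2) that by blast
  qed (use r1 r2 in simp)
qed

lemma pd_pd_log_ratio: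
  assumes K: "holomorphic_on_vec K.polar (cube (pair p p) r)" "\<And>Z. Z \<in> cube (pair p p) r \<Longrightarrow> 0 < Re (K.polar Z)"
    and L: "holomorphic_on_vec L.polar (cube (pair p p) r)" "\<And>Z. Z \<in> cube (pair p p) r \<Longrightarrow> 0 < Re (L.polar Z)"
    and Z: "Z \<in> cube (pair p p) r"
  shows "pd j (pd k log_ratio) Z = pd j (pd k (\<lambda>Z. Ln (L.polar Z))) Z - pd j (pd k (\<lambda>Z. Ln (K.polar Z))) Z"
proof -
  have hK: "holomorphic_on_vec (\<lambda>Z. Ln (K.polar Z)) (cube (pair p p) r)"
    and hL: "holomorphic_on_vec (\<lambda>Z. Ln (L.polar Z)) (cube (pair p p) r)"
    using holomorphic_on_vec_Ln K L by blast+
  have "pd k log_ratio W = pd k (\<lambda>Z. Ln (L.polar Z)) W - pd k (\<lambda>Z. Ln (K.polar Z)) W"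
    if "W \<in> cube (pair p p) r" for W
    unfolding log_ratio_def by (rule pd_diff[OF hL hK that])
  then have "pd j (pd k log_ratio) Z = pd j (\<lambda>W. pd k (\<lambda>Z. Ln (L.polar Z)) W - pd k (\<lambda>Z. Ln (K.polar Z)) W) Z"
    by (rule pd_cong[OF open_cube Z])
  also have "\<dots> = pd j (pd k (\<lambda>Z. Ln (L.polar Z))) Z - pd j (pd k (\<lambda>Z. Ln (K.polar Z))) Z"
    by (rule pd_diff[OF holomorphic_on_vec_pd[OF open_cube hL] holomorphic_on_vec_pd[OF open_cube hK] Z])
  finally show ?thesis .
qed

lemma holomorphic_log_ratio:
  assumes K: "holomorphic_on_vec K.polar (cube (pair p p) r)" "\<And>Z. Z \<in> cube (pair p p) r \<Longrightarrow> 0 < Re (K.polar Z)"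
    and L: "holomorphic_on_vec L.polar (cube (pair p p) r)" "\<And>Z. Z \<in> cube (pair p p) r \<Longrightarrow> 0 < Re (L.polar Z)"
  shows "holomorphic_on_vec log_ratio (cube (pair p p) r)"
  unfolding log_ratio_def
  by (intro holomorphic_on_vec_diff holomorphic_on_vec_Ln K L)

lemma exp_log_ratio:
  assumes "0 < Re (K.polar Z)" "0 < Re (L.polar Z)"
  shows "exp (log_ratio Z) = L.polar Z / K.polar Z"
proof -
  have "K.polar Z \<noteq> 0" "L.polar Z \<noteq> 0" using assms by auto
  then show ?thesis by (simp add: log_ratio_def exp_diff)
qed

text \<open>Nothing is known about the regularity of \<open>\<omega>\<close>, so
  \<open>log \<omega>\<close> cannot be differentiated. Instead \<open>exp (log_ratio Z)\<close> is
  a product of a function of \<open>fstv Z\<close> and one of \<open>sndv Z\<close>; comparing two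
  points with equal \<open>sndv\<close> removes the second factor and shows that the
  \<open>Inr\<close> derivatives of \<open>log_ratio\<close> do not depend on
  \<open>fstv\<close>.\<close>

lemma rescallings_imp_sigma_form_eq:
  assumes res: "rescallings X K L" and z: "z \<in> X"
  shows "sigma_form K z = sigma_form L z"
proof -
  obtain \<omega> where \<omega>: "\<forall>x\<in>X. \<forall>y\<in>X. L x y = \<omega> x * cnj (\<omega> y) * K x y"
    using res by (auto simp: rescallings_def)
  obtain r where r: "r > 0" "cube z r \<subseteq> X"
    and K: "holomorphic_on_vec K.polar (cube (pair z z) r)" "\<And>Z. Z \<in> cube (pair z z) r \<Longrightarrow> 0 < Re (K.polar Z)"
    and L: "holomorphic_on_vec L.polar (cube (pair z z) r)" "\<And>Z. Z \<in> cube (pair z z) r \<Longrightarrow> 0 < Re (L.polar Z)"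
    using common_cube[OF z] by blast
  let ?C = "cube (pair z z) r"
  note hd = holomorphic_log_ratio[OF K L]
  have expd: "exp (log_ratio Z) = \<omega> (fstv Z) * cnj (\<omega> (sndv Z))" if "Z \<in> ?C" for Z
  proof -
    have "K.polar Z \<noteq> 0" using K(2)[OF that] by auto
    moreover have "fstv Z \<in> X" "sndv Z \<in> X" using that r by (auto simp: mem_cube_pair)
    ultimately show ?thesis
      using exp_log_ratio[OF K(2)[OF that] L(2)[OF that]] \<omega> by (simp add: K.polar_def L.polar_def)
  qed
  have indep: "pd (Inr k) log_ratio Z = pd (Inr k) log_ratio W"
    if Z: "Z \<in> ?C" and W: "W \<in> ?C" and ZW: "sndv Z = sndv W" for Z W k
  proof -
    define S where "S = {\<eta>. Z + \<eta> *s axis (Inr k) 1 \<in> ?C} \<inter> {\<eta>. W + \<eta> *s axis (Inr k) 1 \<in> ?C}"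
    have S: "open S" unfolding S_def by (intro open_Int open_line_preimage open_cube)
    have S0: "0 \<in> S" using Z W by (simp add: S_def)
    define g where "g \<eta> = log_ratio (Z + axis (Inr k) \<eta>) - log_ratio (W + axis (Inr k) \<eta>)" for \<eta>
    have WX: "fstv W \<in> X" "fstv Z \<in> X" using W Z r by (auto simp: mem_cube_pair)
    have exp_g: "exp (g \<eta>) = \<omega> (fstv Z) / \<omega> (fstv W)" if "\<eta> \<in> S" for \<eta>
    proof -
      have in_C: "Z + axis (Inr k) \<eta> \<in> ?C" "W + axis (Inr k) \<eta> \<in> ?C"
        using that by (simp_all add: S_def flip: axis_smult)
      have fs: "fstv (V + axis (Inr k) \<eta>) = fstv V" for V
        by (simp add: fstv_def vec_eq_iff axis_def)
      have sn: "sndv (Z + axis (Inr k) \<eta>) = sndv (W + axis (Inr k) \<eta>)"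
        using ZW by (simp add: sndv_def vec_eq_iff axis_def)
      have "sndv (W + axis (Inr k) \<eta>) \<in> X" using in_C(2) r by (auto simp: mem_cube_pair)
      then show ?thesis
        using rescallings_nz(1)[OF \<omega>] by (simp add: g_def exp_diff expd in_C fs sn)
    qed
    have c: "coord_holomorphic_on log_ratio ?C" by (rule holomorphic_on_vec_imp_coord[OF hd])
    then have fd: "(\<lambda>\<eta>. log_ratio (Z + axis (Inr k) \<eta>)) field_differentiable at 0"
      "(\<lambda>\<eta>. log_ratio (W + axis (Inr k) \<eta>)) field_differentiable at 0"
      using Z W by (auto simp: coord_holomorphic_on_def)
    have g': "(g has_field_derivative (pd (Inr k) log_ratio Z - pd (Inr k) log_ratio W)) (at 0)"
      unfolding g_def pd_def using fd by (intro derivative_intros) (simp_all add: field_differentiable_derivI)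
    then have "((\<lambda>\<eta>. exp (g \<eta>)) has_field_derivative
        exp (g 0) * (pd (Inr k) log_ratio Z - pd (Inr k) log_ratio W)) (at 0)"
      by (rule DERIV_fun_exp)
    moreover have "((\<lambda>\<eta>. exp (g \<eta>)) has_field_derivative 0) (at 0)"
      \<comment> \<open>By \<open>exp_g\<close> the exponential is constant near 0; as
        \<open>exp\<close> has no zeros, the derivative of \<open>g\<close> vanishes, with no choice
        of branch involved.\<close>
      using has_field_derivative_transform_within_open[OF DERIV_const S S0] exp_g by (metis (no_types, lifting))
    ultimately have "exp (g 0) * (pd (Inr k) log_ratio Z - pd (Inr k) log_ratio W) = 0"
      by (rule DERIV_unique)
    then show ?thesis by simp
  qed
  have z': "pair z z \<in> ?C" using centre_in_cube[OF r(1)] by simp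
  have zero: "pd (Inl j) (pd (Inr k) log_ratio) (pair z z) = 0" for j k
  proof -
    define S where "S = {\<zeta>. pair z z + \<zeta> *s axis (Inl j) 1 \<in> ?C}"
    have "open S" "0 \<in> S" using z' by (simp_all add: S_def open_line_preimage open_cube)
    have "pd (Inr k) log_ratio (pair z z + axis (Inl j) \<zeta>) = pd (Inr k) log_ratio (pair z z)" if "\<zeta> \<in> S" for \<zeta>
    proof (rule indep)
      show "pair z z + axis (Inl j) \<zeta> \<in> ?C" using that unfolding S_def mem_Collect_eq axis_smult[symmetric] .
      show "sndv (pair z z + axis (Inl j) \<zeta>) = sndv (pair z z)"
        by (simp add: sndv_def vec_eq_iff axis_def)
    qed (rule z')
    then have "\<forall>\<^sub>F \<zeta> in nhds 0. pd (Inr k) log_ratio (pair z z + axis (Inl j) \<zeta>) = pd (Inr k) log_ratio (pair z z)"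
      using eventually_nhds_in_open[OF \<open>open S\<close> \<open>0 \<in> S\<close>] by (auto elim: eventually_mono)
    then have "deriv (\<lambda>\<zeta>. pd (Inr k) log_ratio (pair z z + axis (Inl j) \<zeta>)) 0
       = deriv (\<lambda>\<zeta>. pd (Inr k) log_ratio (pair z z)) 0"
      by (rule deriv_cong_ev) simp
    then show ?thesis by (simp add: pd_def[of "Inl j"])
  qed
  have "pd (Inl j) (pd (Inr k) (\<lambda>Z. Ln (L.polar Z))) (pair z z) = pd (Inl j) (pd (Inr k) (\<lambda>Z. Ln (K.polar Z))) (pair z z)" for j k
    using zero pd_pd_log_ratio[OF K L z'] by simp
  moreover have "sigma_form K z u v = (\<Sum>j\<in>UNIV. \<Sum>k\<in>UNIV.
      pd (Inl j) (pd (Inr k) (\<lambda>Z. Ln (K.polar Z))) (pair z z) * (u $ j * cnj (v $ k)))" for u v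
    by (rule K.sigma_form_eq[OF r(2) K centre_in_cube[OF r(1)]])
  moreover have "sigma_form L z u v = (\<Sum>j\<in>UNIV. \<Sum>k\<in>UNIV.
      pd (Inl j) (pd (Inr k) (\<lambda>Z. Ln (L.polar Z))) (pair z z) * (u $ j * cnj (v $ k)))" for u v
    by (rule L.sigma_form_eq[OF r(2) L centre_in_cube[OF r(1)]])
  ultimately show ?thesis by (intro ext) simp
qed

lemma rescallings_if_sigma_form_eq:
  assumes eq: "\<forall>z\<in>X. sigma_form K z = sigma_form L z"
  shows "rescallings X K L"
proof (cases "X = {}")
  case True
  then show ?thesis by (simp add: rescallings_def)
next
  case False
  then obtain p where p: "p \<in> X" by blast
  obtain r where r: "r > 0" "cube p r \<subseteq> X"
    and K: "holomorphic_on_vec K.polar (cube (pair p p) r)" "\<And>Z. Z \<in> cube (pair p p) r \<Longrightarrow> 0 < Re (K.polar Z)"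
    and L: "holomorphic_on_vec L.polar (cube (pair p p) r)" "\<And>Z. Z \<in> cube (pair p p) r \<Longrightarrow> 0 < Re (L.polar Z)"
    using common_cube[OF p] by blast
  let ?C = "cube (pair p p) r"
  note hd = holomorphic_log_ratio[OF K L]
  have pp: "p \<in> cube p r" using centre_in_cube[OF r(1)] .
  have diag0: "pd (Inl j) (pd (Inr k) log_ratio) (pair w w) = 0" if w: "w \<in> cube p r" for j k w
  proof -
    \<comment> \<open>Evaluation at basis vectors extracts a single coefficient of the form.\<close>
    have single: "(\<Sum>a\<in>UNIV. \<Sum>b\<in>UNIV. h a b * (axis j 1 $ a * cnj (axis k 1 $ b))) = h j k"
      for h :: "'n \<Rightarrow> 'n \<Rightarrow> complex"
    proof -
      have "h a b * (axis j 1 $ a * cnj (axis k 1 $ b)) = (if b = k then (if a = j then h a b else 0) else 0)" for a b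
        by (simp add: axis_def)
      then show ?thesis by simp
    qed
    have "sigma_form K w (axis j 1) (axis k 1) = pd (Inl j) (pd (Inr k) (\<lambda>Z. Ln (K.polar Z))) (pair w w)"
      by (subst K.sigma_form_eq[OF r(2) K w], assumption) (rule single)
    moreover have "sigma_form L w (axis j 1) (axis k 1) = pd (Inl j) (pd (Inr k) (\<lambda>Z. Ln (L.polar Z))) (pair w w)"
      by (subst L.sigma_form_eq[OF r(2) L w], assumption) (rule single)
    moreover have "sigma_form K w = sigma_form L w"
      using eq w r by auto
    ultimately have "pd (Inl j) (pd (Inr k) (\<lambda>Z. Ln (K.polar Z))) (pair w w) = pd (Inl j) (pd (Inr k) (\<lambda>Z. Ln (L.polar Z))) (pair w w)"
      by simp
    then show ?thesis using pd_pd_log_ratio[OF K L, of "pair w w"] w by simp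
  qed
  have mixed: "pd (Inl j) (pd (Inr k) log_ratio) Z = 0" if "Z \<in> ?C" for j k Z
    by (rule holomorphic_eq_0_of_diagonal[where g = "pd (Inl j) (pd (Inr k) log_ratio)", OF _ diag0 that])
       (intro holomorphic_on_vec_pd open_cube hd)
  have indep: "pd (Inr k) log_ratio (pair x y) = pd (Inr k) log_ratio (pair p y)"
    if x: "x \<in> cube p r" and y: "y \<in> cube p r" for x y k
  proof -
    \<comment> \<open>Integration in the first block: along this complex line only
      \<open>Inl\<close> coordinates move, so the derivative is a combination of vanishing mixed
      derivatives.\<close>
    define v where "v = pair (x - p) 0"
    define S where "S = {\<zeta>. pair p y + \<zeta> *s v \<in> ?C}"
    have xv: "pair p y + 1 *s v = pair x y" by (simp add: v_def vec_sum_eq_iff)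
    have "convex S" unfolding S_def by (intro convex_line_preimage convex_cube)
    moreover have "((\<lambda>\<zeta>. pd (Inr k) log_ratio (pair p y + \<zeta> *s v)) has_field_derivative 0) (at \<zeta> within S)"
      if "\<zeta> \<in> S" for \<zeta>
    proof -
      have "(\<Sum>s\<in>UNIV. v $ s * pd s (pd (Inr k) log_ratio) (pair p y + \<zeta> *s v)) = 0"
        using that by (simp add: sum_UNIV_sum v_def S_def mixed)
      then show ?thesis
        using holomorphic_on_vec_line_derivative[OF holomorphic_on_vec_pd[OF open_cube hd], of "pair p y" \<zeta> v "Inr k"] that
        by (simp add: S_def has_field_derivative_at_within)
    qed
    ultimately have "\<exists>c. \<forall>\<zeta>\<in>S. pd (Inr k) log_ratio (pair p y + \<zeta> *s v) = c"
      by (rule has_field_derivative_zero_constant)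
    then obtain c where c: "\<And>\<zeta>. \<zeta> \<in> S \<Longrightarrow> pd (Inr k) log_ratio (pair p y + \<zeta> *s v) = c" by blast
    have "0 \<in> S" using pp y by (simp add: S_def)
    moreover have "1 \<in> S" unfolding S_def mem_Collect_eq xv using x y by simp
    ultimately show ?thesis using c[of 0] c[of 1] unfolding xv by simp
  qed
  have split: "log_ratio (pair x y) - log_ratio (pair p y) = log_ratio (pair x p) - log_ratio (pair p p)"
    if x: "x \<in> cube p r" and y: "y \<in> cube p r" for x y
  proof -
    \<comment> \<open>Integration in the second block: the slices at \<open>x\<close> and at
      \<open>p\<close> have the same \<open>Inr\<close> derivatives by \<open>indep\<close>, so
      their difference is constant.\<close>
    define v where "v = pair 0 (y - p)"
    define S where "S = {\<zeta>. pair x p + \<zeta> *s v \<in> ?C} \<inter> {\<zeta>. pair p p + \<zeta> *s v \<in> ?C}"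
    have "convex S" unfolding S_def by (intro convex_Int convex_line_preimage convex_cube)
    moreover have "((\<lambda>\<zeta>. log_ratio (pair x p + \<zeta> *s v) - log_ratio (pair p p + \<zeta> *s v)) has_field_derivative 0) (at \<zeta> within S)"
      if \<zeta>: "\<zeta> \<in> S" for \<zeta>
    proof -
      \<comment> \<open>The \<open>Inr\<close> coordinates store conjugates, hence
        \<open>cnj \<zeta>\<close> when the point is read as a pair.\<close>
      define y' where "y' = p + cnj \<zeta> *s (y - p)"
      have pv: "pair w p + \<zeta> *s v = pair w y'" for w
        by (simp add: vec_sum_eq_iff v_def y'_def algebra_simps)
      have y': "y' \<in> cube p r" using \<zeta> by (simp add: S_def pv)
      have "((\<lambda>\<zeta>. log_ratio (pair x p + \<zeta> *s v) - log_ratio (pair p p + \<zeta> *s v)) has_field_derivative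
        (\<Sum>s\<in>UNIV. v $ s * pd s log_ratio (pair x p + \<zeta> *s v)) - (\<Sum>s\<in>UNIV. v $ s * pd s log_ratio (pair p p + \<zeta> *s v))) (at \<zeta>)"
        using \<zeta> by (intro DERIV_diff holomorphic_on_vec_line_derivative[OF hd]) (auto simp: S_def)
      moreover have "(\<Sum>s\<in>UNIV. v $ s * pd s log_ratio (pair x p + \<zeta> *s v)) = (\<Sum>s\<in>UNIV. v $ s * pd s log_ratio (pair p p + \<zeta> *s v))"
        by (simp add: sum_UNIV_sum pv indep[OF x y']) (simp add: v_def)
      ultimately show ?thesis by (simp add: has_field_derivative_at_within)
    qed
    ultimately have "\<exists>c. \<forall>\<zeta>\<in>S. log_ratio (pair x p + \<zeta> *s v) - log_ratio (pair p p + \<zeta> *s v) = c"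
      by (rule has_field_derivative_zero_constant)
    then obtain c where c: "\<And>\<zeta>. \<zeta> \<in> S \<Longrightarrow> log_ratio (pair x p + \<zeta> *s v) - log_ratio (pair p p + \<zeta> *s v) = c"
      by blast
    have v1: "pair w p + 1 *s v = pair w y" for w by (simp add: vec_sum_eq_iff v_def)
    have "0 \<in> S" using x pp by (simp add: S_def)
    moreover have "1 \<in> S" unfolding S_def Int_iff mem_Collect_eq v1 using x y pp by simp
    ultimately have "log_ratio (pair x p + 0 *s v) - log_ratio (pair p p + 0 *s v)
        = log_ratio (pair x p + 1 *s v) - log_ratio (pair p p + 1 *s v)"
      by (simp only: c)
    then show ?thesis unfolding v1 by simp
  qed
  have cross0: "cross p x y = 0" if x: "x \<in> cube p r" and y: "y \<in> cube p r" for x y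
  proof -
    have pos: "0 < Re (K a b)" "0 < Re (L a b)" if "a \<in> cube p r" "b \<in> cube p r" for a b
      using K(2)[of "pair a b"] L(2)[of "pair a b"] that by simp_all
    have e: "exp (log_ratio (pair a b)) = L a b / K a b" if "a \<in> cube p r" "b \<in> cube p r" for a b
      using exp_log_ratio[of "pair a b"] pos[OF that] by simp
    have nz: "K a b \<noteq> 0" "L a b \<noteq> 0" if "a \<in> cube p r" "b \<in> cube p r" for a b
      using pos[OF that] by auto
    \<comment> \<open>Exponentiating \<open>split\<close> leaves a relation between the four
      quotients \<open>L / K\<close> at \<open>(x, y)\<close>, \<open>(p, y)\<close>,
      \<open>(x, p)\<close>, \<open>(p, p)\<close>, which is the base-point identity before clearing
      denominators.\<close>
    have "exp (log_ratio (pair x y)) / exp (log_ratio (pair p y)) = exp (log_ratio (pair x p)) / exp (log_ratio (pair p p))"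
      unfolding exp_diff[symmetric] split[OF x y] ..
    then show ?thesis
      unfolding cross_def e[OF x y] e[OF pp y] e[OF x pp] e[OF pp pp]
      using nz[OF x y] nz[OF pp y] nz[OF x pp] nz[OF pp pp] by (simp add: field_simps)
  qed
  have sub: "ball p r \<subseteq> cube p r" by (rule ball_subset_cube)
  have "cross p x y = 0" if "x \<in> X" "y \<in> X" for x y
    by (rule cross_eq_0_global[OF p r(1) _ _ that]) (use sub r(2) cross0 in blast)+
  then show ?thesis by (rule rescallings_if_cross_eq_0[OF p])
qed

theorem rescallings_iff_sigma_form: "rescallings X K L \<longleftrightarrow> (\<forall>z\<in>X. sigma_form K z = sigma_form L z)"
  using rescallings_imp_sigma_form_eq rescallings_if_sigma_form_eq by blast

end

lemma hol_kernelI: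
  assumes "open X" "connected X" "sesqui_holomorphic X K" "nondegenerate X K" "psd_kernel X K"
  shows "hol_kernel X K"
proof
  show "open X" "connected X" by fact+
  show "holomorphic_on_vec (\<lambda>x. K x y) X" if "y \<in> X" for y
    using assms(3) that by (simp add: sesqui_holomorphic_def)
  show "K y x = cnj (K x y)" if "x \<in> X" "y \<in> X" for x y
    by (rule psd_kernel_hermitian[OF assms(5) that])
  fix x assume "x \<in> X"
  then have "K x x \<in> \<real>" "0 < Re (K x x)" using assms(4) by (auto simp: nondegenerate_def)
  then show "K x x = of_real (kdiag K x)" "0 < kdiag K x" by (simp_all add: kdiag_def)
qed

theorem corollary3p9:
  fixes X :: "(complex ^ 'n) set"
    and K L :: "complex ^ 'n \<Rightarrow> complex ^ 'n \<Rightarrow> complex"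
  assumes "open X" and "connected X"
    and "sesqui_holomorphic X K" and "nondegenerate X K" and "psd_kernel X K"
    and "sesqui_holomorphic X L" and "nondegenerate X L" and "psd_kernel X L"
  shows "(rescallings X K L \<longleftrightarrow> (\<forall>z\<in>X. sigma_form K z = sigma_form L z)) \<and>
         (rescallings X K L \<longleftrightarrow> (\<forall>x\<in>X. \<forall>y\<in>X. delta1 K x y = delta1 L x y)) \<and>
         (rescallings X K L \<longleftrightarrow> (\<forall>x\<in>X. \<forall>y\<in>X. delta2 K x y = delta2 L x y))"
proof -
  interpret K: hol_kernel X K by (rule hol_kernelI) fact+
  interpret L: hol_kernel X L by (rule hol_kernelI) fact+
  interpret hol_kernel_pair X K L ..
  show ?thesis
    using rescallings_iff_sigma_form rescallings_iff_delta1 rescallings_iff_delta2 by blast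
qed

end
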